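(* Assume that $r_{ij}\ne0$ for all $i\ne j$ and $c_2>r_{21}+r_{23}$. Let $g=y^{\eta r_{12}+\epsilon c_2}$ and $h=y^{b/d}-x^{(b-a)/d}z^{a/d}$. Then $$I^*=(z^{c_3},g,h)+(p_{\alpha,\beta}\mid(\alpha,\beta)\in A)+(q_{\gamma,\sigma}\mid(\gamma,\sigma)\in B).$$ Furthermore, \begin{enumerate} \item If $\beta_h<\epsilon$ then $I^*=(h)+(p_{\alpha,\beta}\mid(\alpha,\beta)\in A,\ \beta<\beta_h)+(q_{\gamma,\sigma}\mid(\gamma,\sigma)\in B)$. \item If $\beta_h\ge\epsilon$ then $I^*=(g)+(p_{\alpha,\beta}\mid(\alpha,\beta)\in A)+(q_{\gamma,\sigma}\mid(\gamma,\sigma)\in B)$. \item The minimal generators of $I^*$ form a Gr\"obner basis of $I^*$ with respect to the reverse lexicographic order. \item $\mu(I^* )\le\max(r_{13},r_{23})+3$. \end{enumerate}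
   Context: Let $K$ be a field and let $n_1<n_2<n_3$ be positive integers with $\gcd(n_1,n_2,n_3)=1$ that minimally generate the numerical semigroup $H=\langle n_1,n_2,n_3\rangle$. Let $S=K[x,y,z]$ with the standard grading, and let $I=I_H$ be the kernel of $S\to K[t]$, $x\mapsto t^{n_1}$, $y\mapsto t^{n_2}$, $z\mapsto t^{n_3}$. Assume that $I$ is not a complete intersection. For nonzero $f\in S$, $f^*$ is its homogeneous component of smallest degree, and $I^*=(f^*\mid 0\neq f\in I)$; $\mu$ denotes the minimal number of generators. The reverse lexicographic order is the graded one with $x>y>z$. $\mathbb N$ contains $0$. Let $a=n_2-n_1$, $b=n_3-n_1$, $d=\gcd(a,b)$. Let $c_1,c_2,c_3$ be the smallest positive integers such that $c_1n_1\in\langle n_2,n_3\rangle$, $c_2n_2\in\langle n_1,n_3\rangle$, $c_3n_3\in\langle n_1,n_2\rangle$, and let $r_{ij}$ be non-negative integers with $c_1n_1=r_{12}n_2+r_{13}n_3$, $c_2n_2=r_{21}n_1+r_{23}n_3$, $c_3n_3=r_{31}n_1+r_{32}n_2$. Put $\delta_1=c_1-r_{12}-r_{13}$ and $\delta_2=c_2-r_{21}-r_{23}$ (both positive). Let $\alpha_h,\beta_h$ be the positive integers determined by $\alpha_hc_1+\beta_hr_{21}=(b-a)/d$, $\alpha_hr_{12}+\beta_hc_2=b/d$, $-\alpha_hr_{13}+\beta_hr_{23}=a/d$. For a real number $r\geq 0$ define $\varphi_r:\mathbb N\to\mathbb N$ by $\varphi_r(t)=rt+1$ if $rt\in\mathbb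 N$ and $\varphi_r(t)=\lceil rt\rceil$ otherwise. One has $\frac{\delta_2}{\delta_1}<\frac{r_{23}}{r_{13}}$. Let $\epsilon$ be the smallest positive integer for which there is an integer $e$ with $\frac{\delta_2}{\delta_1}<\frac{e}{\epsilon}\le\frac{r_{23}}{r_{13}}$, and let $\eta$ be the smallest such $e$. Set $A$: let $\alpha_0=1,\beta_0=0$. For $i\ge0$, consider the system in $(\alpha,\beta)\in\mathbb N^2$: $\alpha r_{13}-\beta r_{23}>0$, $\ \alpha r_{13}-\beta r_{23}<\alpha_ir_{13}-\beta_ir_{23}$, $\ \beta>\beta_i$. If it has solutions, let $\beta_{i+1}$ be the smallest value of $\beta$ among its solutions and $\alpha_{i+1}=\varphi_{r_{23}/r_{13}}(\beta_{i+1})$; otherwise the sequence stops (it is always finite). Let $t$ be the largest index with $\beta_t<\epsilon$ and $A=\{(\alpha_i,\beta_i)\mid i=0,\ldots,t\}$. For $\alpha,\beta\in\mathbb N$ with $\alpha r_{13}-\beta r_{23}\ge0$, let $p_{\alpha,\beta}=y^{\alpha r_{12}+\beta c_2}z^{\alpha r_{13}-\beta r_{23}}$. Set $B$: let $\gamma_0=0,\sigma_0=1$. For $i\ge0$, consider the system in $(\gamma,\sigma)\in\mathbb N^2$: $-\gamma\delta_1+\sigma\delta_2>0$, $\ -\gamma r_{13}+\sigma r_{23}<-\gamma_ir_{13}+\sigma_ir_{23}$, $\ \gamma>\gamma_i$. If it has solutions, let $\gamma_{i+1}$ be the smallest value of $\gamma$ among its solutions and $\sigma_{i+1}=\varphi_{\delta_1/\delta_2}(\gamma_{i+1})$;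 otherwise the sequence stops (it is always finite). Let $u$ be the largest index and $B=\{(\gamma_i,\sigma_i)\mid i=0,\ldots,u\}$. For $\gamma,\sigma\in\mathbb N$ with $-\gamma r_{13}+\sigma r_{23}>0$, let $q_{\gamma,\sigma}=x^{\gamma c_1+\sigma r_{21}}z^{-\gamma r_{13}+\sigma r_{23}}$.
   Formalization: In (1) and (2) the missing generator z^{c_3} is added, since without it both always fail; the case β_h=ε is moved from (2) to (1), since (2) fails there (e.g. H=⟨6,7,11⟩); in (3) the minimal generators are taken among the displayed ones. *)

theory Defs
  imports Complex_Main
    "HOL-Library.Poly_Mapping"
    "HOL-Computational_Algebra.Polynomial"
begin

section \<open>The polynomial ring $K[x,y,z]$\<close>

datatype var = X | Y | Z

type_synonym mon = "var \<Rightarrow>\<^sub>0 nat"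

type_synonym 'k poly3 = "mon \<Rightarrow>\<^sub>0 'k"

definition indet :: "var \<Rightarrow> 'k::field poly3" where
  "indet v = Poly_Mapping.single (Poly_Mapping.single v 1) 1"

definition ideal_gen :: "'a::comm_ring_1 set \<Rightarrow> 'a set" where
  "ideal_gen G = module.span (*) G"

text \<open>Minimal number of generators. All ideals below are finitely generated, so the set of
  admissible numbers is nonempty.\<close>

definition mu :: "'a::comm_ring_1 set \<Rightarrow> nat" where
  "mu I = (LEAST k. \<exists>G. finite G \<and> card G = k \<and> ideal_gen G = I)"

definition minimal_generating_set :: "'a::comm_ring_1 set \<Rightarrow> 'a set \<Rightarrow> bool" where
  "minimal_generating_set G I \<longleftrightarrow> ideal_gen G = I \<and> (\<forall>G'. G' \<subset> G \<longrightarrow> ideal_gen G' \<noteq> I)"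

definition regular_sequence :: "'a::comm_ring_1 list \<Rightarrow> bool" where
  "regular_sequence fs \<longleftrightarrow>
     ideal_gen (set fs) \<noteq> UNIV \<and>
     (\<forall>i<length fs. \<forall>f. f * fs ! i \<in> ideal_gen (set (take i fs)) \<longrightarrow> f \<in> ideal_gen (set (take i fs)))"

definition complete_intersection :: "'a::comm_ring_1 set \<Rightarrow> bool" where
  "complete_intersection I \<longleftrightarrow> (\<exists>fs. regular_sequence fs \<and> I = ideal_gen (set fs))"

text \<open>Standard grading and initial forms.\<close>

definition mdeg :: "mon \<Rightarrow> nat" where
  "mdeg m = (\<Sum>v\<in>Poly_Mapping.keys m. Poly_Mapping.lookup m v)"

definition hom_component :: "nat \<Rightarrow> 'k::field poly3 \<Rightarrow> 'k poly3" where
  "hom_component k f =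
     (\<Sum>m\<in>{m \<in> Poly_Mapping.keys f. mdeg m = k}. Poly_Mapping.single m (Poly_Mapping.lookup f m))"

definition initial_form :: "'k::field poly3 \<Rightarrow> 'k poly3" where
  "initial_form f = hom_component (Min (mdeg ` Poly_Mapping.keys f)) f"

definition initial_form_ideal :: "'k::field poly3 set \<Rightarrow> 'k poly3 set" where
  "initial_form_ideal I = ideal_gen {initial_form f | f. f \<in> I \<and> f \<noteq> 0}"

text \<open>The graded reverse lexicographic order with $x > y > z$, leading monomials and
  Groebner bases.\<close>

definition revlex_less :: "mon \<Rightarrow> mon \<Rightarrow> bool" where
  "revlex_less m m' \<longleftrightarrow>
     mdeg m < mdeg m' \<or>
     mdeg m = mdeg m' \<and>
       (Poly_Mapping.lookup m Z > Poly_Mapping.lookup m' Z \<or>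
        Poly_Mapping.lookup m Z = Poly_Mapping.lookup m' Z \<and>
          Poly_Mapping.lookup m Y > Poly_Mapping.lookup m' Y)"

definition lead_mon :: "'k::field poly3 \<Rightarrow> mon" where
  "lead_mon f = (THE m. m \<in> Poly_Mapping.keys f \<and>
                        (\<forall>m'\<in>Poly_Mapping.keys f. m' \<noteq> m \<longrightarrow> revlex_less m' m))"

definition lead_mon_ideal :: "'k::field poly3 set \<Rightarrow> 'k poly3 set" where
  "lead_mon_ideal F = ideal_gen {Poly_Mapping.single (lead_mon f) 1 | f. f \<in> F \<and> f \<noteq> 0}"

definition groebner_basis :: "'k::field poly3 set \<Rightarrow> 'k poly3 set \<Rightarrow> bool" where
  "groebner_basis G J \<longleftrightarrow> finite G \<and> G \<subseteq> J \<and> lead_mon_ideal G = lead_mon_ideal J"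

section \<open>Numerical semigroups and their defining ideals\<close>

definition nat_semigroup :: "nat set \<Rightarrow> nat set" where
  "nat_semigroup A = {(\<Sum>a\<in>F. k a * a) | k F. finite F \<and> F \<subseteq> A}"

definition minimally_generates :: "nat set \<Rightarrow> nat set \<Rightarrow> bool" where
  "minimally_generates A H \<longleftrightarrow>
     nat_semigroup A = H \<and> (\<forall>B. B \<subset> A \<longrightarrow> nat_semigroup B \<noteq> H)"

definition subst_poly :: "(var \<Rightarrow> 'k::field poly) \<Rightarrow> 'k poly3 \<Rightarrow> 'k poly" where
  "subst_poly s f =
     (\<Sum>m\<in>Poly_Mapping.keys f.
        smult (Poly_Mapping.lookup f m) (\<Prod>v\<in>Poly_Mapping.keys m. s v ^ Poly_Mapping.lookup m v))"

definition semigroup_ideal :: "nat \<Rightarrow> nat \<Rightarrow> nat \<Rightarrow> 'k::field poly3 set" where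
  "semigroup_ideal n1 n2 n3 =
     {f. subst_poly (case_var (monom 1 n1) (monom 1 n2) (monom 1 n3)) f = 0}"

definition least_mult :: "nat \<Rightarrow> nat set \<Rightarrow> nat" where
  "least_mult n A = (LEAST c. 0 < c \<and> c * n \<in> nat_semigroup A)"

section \<open>The combinatorial data\<close>

definition phi :: "real \<Rightarrow> nat \<Rightarrow> nat" where
  "phi r t = (if r * real t \<in> \<nat> then nat \<lfloor>r * real t\<rfloor> + 1 else nat \<lceil>r * real t\<rceil>)"

definition eps_of :: "real \<Rightarrow> real \<Rightarrow> nat" where
  "eps_of lo hi = (LEAST n. 0 < n \<and> (\<exists>e::int. lo < real_of_int e / real n \<and> real_of_int e / real n \<le> hi))"

definition eta_of :: "real \<Rightarrow> real \<Rightarrow> int" where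
  "eta_of lo hi = (LEAST e::int. lo < real_of_int e / real (eps_of lo hi) \<and>
                                 real_of_int e / real (eps_of lo hi) \<le> hi)"

text \<open>The sequences defining $A$ and $B$ take the value \<^const>\<open>None\<close> once they have stopped.\<close>

definition A_solutions :: "nat \<Rightarrow> nat \<Rightarrow> nat \<times> nat \<Rightarrow> (nat \<times> nat) set" where
  "A_solutions r13 r23 p = {(\<alpha>, \<beta>).
     int \<alpha> * int r13 - int \<beta> * int r23 > 0 \<and>
     int \<alpha> * int r13 - int \<beta> * int r23 < int (fst p) * int r13 - int (snd p) * int r23 \<and>
     \<beta> > snd p}"

definition A_next :: "nat \<Rightarrow> nat \<Rightarrow> nat \<times> nat \<Rightarrow> (nat \<times> nat) option" where
  "A_next r13 r23 p =
     (if A_solutions r13 r23 p = {} then None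
      else let \<beta>' = (LEAST \<beta>. \<exists>\<alpha>. (\<alpha>, \<beta>) \<in> A_solutions r13 r23 p)
           in Some (phi (real r23 / real r13) \<beta>', \<beta>'))"

primrec A_seq :: "nat \<Rightarrow> nat \<Rightarrow> nat \<Rightarrow> (nat \<times> nat) option" where
  "A_seq r13 r23 0 = Some (1, 0)"
| "A_seq r13 r23 (Suc i) = Option.bind (A_seq r13 r23 i) (A_next r13 r23)"

definition A_set :: "nat \<Rightarrow> nat \<Rightarrow> nat \<Rightarrow> (nat \<times> nat) set" where
  "A_set r13 r23 \<epsilon> =
     (let t = (GREATEST i. \<exists>\<alpha> \<beta>. A_seq r13 r23 i = Some (\<alpha>, \<beta>) \<and> \<beta> < \<epsilon>)
      in {p. \<exists>i\<le>t. A_seq r13 r23 i = Some p})"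

definition B_solutions :: "nat \<Rightarrow> nat \<Rightarrow> int \<Rightarrow> int \<Rightarrow> nat \<times> nat \<Rightarrow> (nat \<times> nat) set" where
  "B_solutions r13 r23 \<delta>1 \<delta>2 p = {(\<gamma>, \<sigma>).
     - int \<gamma> * \<delta>1 + int \<sigma> * \<delta>2 > 0 \<and>
     - int \<gamma> * int r13 + int \<sigma> * int r23 < - int (fst p) * int r13 + int (snd p) * int r23 \<and>
     \<gamma> > fst p}"

definition B_next :: "nat \<Rightarrow> nat \<Rightarrow> int \<Rightarrow> int \<Rightarrow> nat \<times> nat \<Rightarrow> (nat \<times> nat) option" where
  "B_next r13 r23 \<delta>1 \<delta>2 p =
     (if B_solutions r13 r23 \<delta>1 \<delta>2 p = {} then None
      else let \<gamma>' = (LEAST \<gamma>. \<exists>\<sigma>. (\<gamma>, \<sigma>) \<in> B_solutions r13 r23 \<delta>1 \<delta>2 p)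
           in Some (\<gamma>', phi (real_of_int \<delta>1 / real_of_int \<delta>2) \<gamma>'))"

primrec B_seq :: "nat \<Rightarrow> nat \<Rightarrow> int \<Rightarrow> int \<Rightarrow> nat \<Rightarrow> (nat \<times> nat) option" where
  "B_seq r13 r23 \<delta>1 \<delta>2 0 = Some (0, 1)"
| "B_seq r13 r23 \<delta>1 \<delta>2 (Suc i) = Option.bind (B_seq r13 r23 \<delta>1 \<delta>2 i) (B_next r13 r23 \<delta>1 \<delta>2)"

definition B_set :: "nat \<Rightarrow> nat \<Rightarrow> int \<Rightarrow> int \<Rightarrow> (nat \<times> nat) set" where
  "B_set r13 r23 \<delta>1 \<delta>2 =
     (let u = (GREATEST i. B_seq r13 r23 \<delta>1 \<delta>2 i \<noteq> None)
      in {p. \<exists>i\<le>u. B_seq r13 r23 \<delta>1 \<delta>2 i = Some p})"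

text \<open>In the next two definitions the subtraction is on \<^typ>\<open>nat\<close>: $p_{\alpha,\beta}$ and
  $q_{\gamma,\sigma}$ are only meaningful when it does not truncate, as is the case for the
  elements of $A$ and $B$.\<close>

definition p_mon :: "nat \<Rightarrow> nat \<Rightarrow> nat \<Rightarrow> nat \<Rightarrow> nat \<times> nat \<Rightarrow> 'k::field poly3" where
  "p_mon c2 r12 r13 r23 = (\<lambda>(\<alpha>, \<beta>).
     indet Y ^ (\<alpha> * r12 + \<beta> * c2) * indet Z ^ (\<alpha> * r13 - \<beta> * r23))"

definition q_mon :: "nat \<Rightarrow> nat \<Rightarrow> nat \<Rightarrow> nat \<Rightarrow> nat \<times> nat \<Rightarrow> 'k::field poly3" where
  "q_mon c1 r21 r13 r23 = (\<lambda>(\<gamma>, \<sigma>).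
     indet X ^ (\<gamma> * c1 + \<sigma> * r21) * indet Z ^ (\<sigma> * r23 - \<gamma> * r13))"

end

theory Submission
  imports Defs
begin

text \<open>
  Write \<open>x\<^sup>m\<close> for the monomial with exponent \<open>m\<close>, and give \<open>x, y, z\<close> the weights \<open>n1, n2, n3\<close>.
  The toric ideal \<open>I\<close> is homogeneous for the weight, and an element of weight \<open>w\<close> lies in \<open>I\<close> exactly
  when its coefficients add up to zero. Reading off components of smallest degree, \<open>I\<^sup>*\<close> is spanned by
  two kinds of elements: monomials \<open>x\<^sup>m\<close> for which another monomial of the same weight has larger
  degree (below such an \<open>m\<close> is called improvable), and differences of monomials of the same weight
  and the same degree. The relations that preserve weight and degree form a cyclic group, generated
  by the exponent of \<open>h\<close>, so the differences are multiples of \<open>h\<close> (\<open>initial_ideal_eq\<close>). Everything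
  thus depends on which exponents are improvable.

  Herzog's minimality argument shows that the lattice of relations among \<open>n1, n2, n3\<close> has the basis
  \<open>v1 = (c1, -r12, -r13)\<close>, \<open>v2 = (-r21, c2, -r23)\<close> (\<open>kernel_in_lattice\<close>). Their coordinate sums are
  \<open>\<delta>1\<close> and \<open>\<delta>2\<close>, so \<open>m\<close> is improvable iff \<open>m + \<lambda> v1 + \<mu> v2\<close> has no negative coordinate for some
  integers with \<open>\<lambda> \<delta>1 + \<mu> \<delta>2 > 0\<close>. The signs of \<open>\<lambda>\<close> and \<open>\<mu>\<close> give the generators
  (\<open>improvable_cases\<close>): if both are positive, \<open>z^c3\<close> divides \<open>x\<^sup>m\<close>; if \<open>(\<lambda>, \<mu>) = (\<alpha>, -\<beta>)\<close> with
  \<open>\<alpha> > 0\<close> and \<open>\<beta> \<ge> 0\<close>, then \<open>x\<^sup>m\<close> is divisible by \<open>p\<close> at \<open>(\<alpha>, \<beta>)\<close>, or by a pure power of \<open>y\<close> when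
  \<open>\<alpha> / \<beta>\<close> lies in the interval that defines \<open>\<epsilon>\<close> and \<open>\<eta>\<close>, which makes it a multiple of \<open>g\<close>; if
  \<open>(\<lambda>, \<mu>) = (-\<gamma>, \<sigma>)\<close> with \<open>\<gamma> \<ge> 0\<close> and \<open>\<sigma> > 0\<close>, it is divisible by \<open>q\<close> at \<open>(\<gamma>, \<sigma>)\<close>.

  Among all \<open>p\<close> and all \<open>q\<close> only those matter at which the exponent of \<open>z\<close> takes a new strict
  minimum, and the two recursive sequences enumerate precisely these. Both are instances of one
  construction, the locale \<open>staircase\<close>.

  The binomial \<open>h\<close> comes from \<open>\<alpha>h v1 - \<beta>h v2\<close>. If \<open>\<beta>h \<le> \<epsilon>\<close>, subtracting multiples of \<open>h\<close> lowers
  \<open>(\<alpha>, \<beta>)\<close> by \<open>(\<alpha>h, \<beta>h)\<close>, which removes \<open>g\<close> and every \<open>p\<close> with \<open>\<beta> \<ge> \<beta>h\<close>. If \<open>\<beta>h > \<epsilon>\<close>, both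
  terms of \<open>h\<close> are improvable, one being a multiple of \<open>g\<close> and the other of some \<open>q\<close>.

  For the Groebner basis: the leading term of \<open>h\<close> is its power of \<open>y\<close>. An element of \<open>I\<^sup>*\<close> whose
  leading monomial is not improvable has a further monomial of the same weight and degree, which
  differs from the leading one by a multiple of the exponent of \<open>h\<close>; so the leading term of \<open>h\<close>
  divides (\<open>lead_mon_initial_ideal\<close>). A monomial generator that is divisible by no term of \<open>h\<close> must be
  a multiple of a monomial of any generating set taken from the list (\<open>groebner_basis_of_generators\<close>).

  For the bound on \<open>\<mu>\<close>: two generators besides the \<open>p\<close> and \<open>q\<close> suffice. The exponents of \<open>z\<close> are
  distinct numbers in \<open>{1..r13}\<close> along \<open>p\<close> and distinct numbers in \<open>{1..r23}\<close> along \<open>q\<close>, and at most one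
  of them occurs in both lists, because two coincidences would produce a fraction equal to
  \<open>r23 / r13\<close> with denominator at least \<open>2 \<epsilon>\<close> within bounds that only allow less (\<open>card_steps\<close>).
\<close>

section \<open>Polynomials as combinations of monomials\<close>

abbreviation monomial :: "mon \<Rightarrow> 'k::field poly3" where
  "monomial m \<equiv> Poly_Mapping.single m 1"

definition xyz :: "nat \<Rightarrow> nat \<Rightarrow> nat \<Rightarrow> mon" where
  "xyz i j k = Poly_Mapping.single X i + Poly_Mapping.single Y j + Poly_Mapping.single Z k"

lemma lookup_xyz [simp]:
  "Poly_Mapping.lookup (xyz i j k) X = i"
  "Poly_Mapping.lookup (xyz i j k) Y = j"
  "Poly_Mapping.lookup (xyz i j k) Z = k"
  by (simp_all add: xyz_def lookup_add lookup_single)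

lemma mon_eq_iff:
  "m = m' \<longleftrightarrow> Poly_Mapping.lookup m X = Poly_Mapping.lookup m' X \<and>
     Poly_Mapping.lookup m Y = Poly_Mapping.lookup m' Y \<and>
     Poly_Mapping.lookup m Z = Poly_Mapping.lookup m' Z"
  for m m' :: mon
proof -
  have "(\<forall>v. P v) \<longleftrightarrow> P X \<and> P Y \<and> P Z" for P :: "var \<Rightarrow> bool"
    by (metis var.exhaust)
  then show ?thesis by (simp add: poly_mapping_eq_iff fun_eq_iff)
qed

lemma xyz_add: "xyz i j k + xyz i' j' k' = xyz (i + i') (j + j') (k + k')"
  by (simp add: mon_eq_iff lookup_add)

lemma mono_mult: "monomial m * monomial m' = monomial (m + m')"
  by (simp add: mult_single)

lemma UNIV_var: "(UNIV :: var set) = {X, Y, Z}"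
  by (auto intro: var.exhaust)

lemma finite_var: "finite (A :: var set)"
  by (rule finite_subset[of _ "{X, Y, Z}"]) (auto intro: var.exhaust)

lemma sum_keys_var:
  assumes "\<And>v. Poly_Mapping.lookup m v = 0 \<Longrightarrow> F v = 0"
  shows "(\<Sum>v\<in>Poly_Mapping.keys (m :: mon). F v :: nat) = F X + F Y + F Z"
proof -
  have "(\<Sum>v\<in>Poly_Mapping.keys m. F v) = (\<Sum>v\<in>UNIV. F v)"
    by (rule sum.mono_neutral_left) (auto simp: finite_var in_keys_iff assms)
  then show ?thesis by (simp add: UNIV_var)
qed

lemma mdeg_eq: "mdeg m = Poly_Mapping.lookup m X + Poly_Mapping.lookup m Y + Poly_Mapping.lookup m Z"
  unfolding mdeg_def by (rule sum_keys_var) simp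

definition wt :: "nat \<Rightarrow> nat \<Rightarrow> nat \<Rightarrow> mon \<Rightarrow> nat" where
  "wt n1 n2 n3 m =
     n1 * Poly_Mapping.lookup m X + n2 * Poly_Mapping.lookup m Y + n3 * Poly_Mapping.lookup m Z"

lemma mdeg_add: "mdeg (m + m') = mdeg m + mdeg m'"
  by (simp add: mdeg_eq lookup_add)

lemma wt_add: "wt n1 n2 n3 (m + m') = wt n1 n2 n3 m + wt n1 n2 n3 m'"
  by (simp add: wt_def lookup_add algebra_simps)

lemma poly_eq_sum_monomials:
  "f = (\<Sum>m\<in>Poly_Mapping.keys f. Poly_Mapping.single m (Poly_Mapping.lookup f m))"
  by (rule poly_mapping_eqI)
    (simp add: lookup_sum lookup_single when_def in_keys_iff)

lemma indet_power: "(indet v :: 'k::field poly3) ^ n = monomial (Poly_Mapping.single v n)"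
proof (induction n)
  case (Suc n)
  have "Poly_Mapping.single v (Suc n) = Poly_Mapping.single v 1 + Poly_Mapping.single v n"
    by (simp only: single_add[symmetric] plus_1_eq_Suc)
  then show ?case by (metis Suc.IH indet_def mono_mult power_Suc)
qed simp

lemma indet_powers:
  "(indet X :: 'k::field poly3) ^ i = monomial (xyz i 0 0)"
  "(indet Y :: 'k::field poly3) ^ j = monomial (xyz 0 j 0)"
  "(indet Z :: 'k::field poly3) ^ k = monomial (xyz 0 0 k)"
  by (simp_all add: indet_power xyz_def)

section \<open>Generated ideals\<close>

lemma ring_module: "module ((*) :: 'a::comm_ring_1 \<Rightarrow> 'a \<Rightarrow> 'a)"
  by unfold_locales (simp_all add: algebra_simps)

lemmas ideal_gen_base = module.span_base[OF ring_module, folded ideal_gen_def]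
lemmas ideal_gen_zero = module.span_zero[OF ring_module, folded ideal_gen_def]
lemmas ideal_gen_add = module.span_add[OF ring_module, folded ideal_gen_def]
lemmas ideal_gen_diff = module.span_diff[OF ring_module, folded ideal_gen_def]
lemmas ideal_gen_mult = module.span_scale[OF ring_module, folded ideal_gen_def]
lemmas ideal_gen_sum = module.span_sum[OF ring_module, folded ideal_gen_def]
lemmas ideal_gen_mono = module.span_mono[OF ring_module, folded ideal_gen_def]

lemma ideal_gen_subset:
  assumes "F \<subseteq> ideal_gen G"
  shows "ideal_gen F \<subseteq> ideal_gen (G :: 'a::comm_ring_1 set)"
  using module.span_minimal[OF ring_module assms[unfolded ideal_gen_def]
      module.subspace_span[OF ring_module]]
  unfolding ideal_gen_def .

lemma ideal_gen_eqI:
  assumes "F \<subseteq> ideal_gen G" "G \<subseteq> ideal_gen F"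
  shows "ideal_gen F = ideal_gen (G :: 'a::comm_ring_1 set)"
  using assms ideal_gen_subset by blast

lemma mono_in_ideal_gen:
  assumes "monomial e \<in> ideal_gen G"
  shows "Poly_Mapping.single (t + e) c \<in> ideal_gen (G :: 'k::field poly3 set)"
  using ideal_gen_mult[OF assms, of "Poly_Mapping.single t c"] by (simp add: mult_single)

lemma mono_in_ideal_gen':
  assumes "monomial (xyz i j k) \<in> ideal_gen G" "i \<le> i'" "j \<le> j'" "k \<le> k'"
  shows "monomial (xyz i' j' k') \<in> ideal_gen (G :: 'k::field poly3 set)"
  using mono_in_ideal_gen[OF assms(1), of "xyz (i' - i) (j' - j) (k' - k)" 1] assms(2-)
  by (simp add: xyz_add)

text \<open>Every coefficient of a linear combination splits into terms, so an ideal is reached by adding one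
  term times one generator at a time. Along such steps supports and sums of coefficients are easy to
  control.\<close>
lemma ideal_gen_induct [consumes 1, case_names zero add]:
  assumes "f \<in> ideal_gen (G :: 'k::field poly3 set)"
    and "Q 0"
    and "\<And>f g t c. g \<in> G \<Longrightarrow> Q f \<Longrightarrow> Q (f + Poly_Mapping.single t c * g)"
  shows "Q f"
proof (rule module.span_induct_alt[OF ring_module assms(1)[unfolded ideal_gen_def], of Q])
  fix c x y :: "'k poly3" assume x: "x \<in> G" and y: "Q y"
  have "Q (y + (\<Sum>m\<in>M. Poly_Mapping.single m (Poly_Mapping.lookup c m)) * x)" if "finite M" for M
    using that
  proof (induction M)
    case (insert m M)
    from assms(3)[OF x insert.IH, of m "Poly_Mapping.lookup c m"] insert.hyps show ?case
      by (simp add: algebra_simps)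
  qed (use y in simp)
  from this[of "Poly_Mapping.keys c"] show "Q (c * x + y)"
    by (simp add: add.commute flip: poly_eq_sum_monomials)
qed (rule assms(2))

text \<open>For monomial generators this is the divisibility criterion for monomial ideals; it is needed for
  generating sets that also contain a binomial.\<close>
lemma key_in_ideal_gen:
  assumes "f \<in> ideal_gen (G :: 'k::field poly3 set)" "m \<in> Poly_Mapping.keys f"
  obtains g e t where "g \<in> G" "e \<in> Poly_Mapping.keys g" "m = t + e"
proof -
  have "\<exists>g\<in>G. \<exists>e\<in>Poly_Mapping.keys g. \<exists>t. m = t + e"
    using assms
  proof (induction rule: ideal_gen_induct)
    case (add f g t c)
    show ?case
    proof (cases "m \<in> Poly_Mapping.keys f")
      case False
      then have "m \<in> Poly_Mapping.keys (Poly_Mapping.single t c * g)"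
        using add.prems keys_add[of f] by blast
      then obtain u e where "u \<in> Poly_Mapping.keys (Poly_Mapping.single t c)"
        "e \<in> Poly_Mapping.keys g" "m = u + e"
        using keys_mult[of "Poly_Mapping.single t c" g] by blast
      with add.hyps show ?thesis by blast
    qed (use add.IH in blast)
  qed simp
  then show ?thesis using that by blast
qed

section \<open>Initial forms in a toric ideal\<close>

lemma subst_poly_monomials:
  "subst_poly (case_var (monom 1 n1) (monom 1 n2) (monom 1 n3)) f =
     (\<Sum>m\<in>Poly_Mapping.keys f. monom (Poly_Mapping.lookup f m) (wt n1 n2 n3 m) :: 'k::field poly)"
  unfolding subst_poly_def
proof (rule sum.cong)
  fix m :: mon
  let ?s = "case_var (monom 1 n1) (monom 1 n2) (monom 1 n3) :: var \<Rightarrow> 'k poly"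
  have "(\<Prod>v\<in>Poly_Mapping.keys m. ?s v ^ Poly_Mapping.lookup m v) =
        (\<Prod>v\<in>UNIV. ?s v ^ Poly_Mapping.lookup m v)"
    by (rule prod.mono_neutral_left) (auto simp: finite_var in_keys_iff)
  also have "\<dots> = monom 1 (wt n1 n2 n3 m)"
    by (simp add: UNIV_var monom_power mult_monom wt_def mult.assoc)
       (simp add: add.assoc)
  finally show "smult (Poly_Mapping.lookup f m)
      (\<Prod>v\<in>Poly_Mapping.keys m. ?s v ^ Poly_Mapping.lookup m v) =
      monom (Poly_Mapping.lookup f m) (wt n1 n2 n3 m)"
    by (simp add: smult_monom)
qed simp

text \<open>The substitution sends each monomial to a power of the variable given by its weight, so only the sum
  of the coefficients in each weight survives.\<close>
lemma semigroup_ideal_iff: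
  "f \<in> semigroup_ideal n1 n2 n3 \<longleftrightarrow>
    (\<forall>w. (\<Sum>m | m \<in> Poly_Mapping.keys f \<and> wt n1 n2 n3 m = w. Poly_Mapping.lookup f m) = 0)"
proof -
  have "coeff (subst_poly (case_var (monom 1 n1) (monom 1 n2) (monom 1 n3)) f) w =
      (\<Sum>m | m \<in> Poly_Mapping.keys f \<and> wt n1 n2 n3 m = w. Poly_Mapping.lookup f m)" for w
  proof -
    have "(\<Sum>m | m \<in> Poly_Mapping.keys f \<and> wt n1 n2 n3 m = w. Poly_Mapping.lookup f m) =
      (\<Sum>m\<in>Poly_Mapping.keys f. if wt n1 n2 n3 m = w then Poly_Mapping.lookup f m else 0)"
      using sum.inter_filter[of "Poly_Mapping.keys f" "Poly_Mapping.lookup f" "\<lambda>m. wt n1 n2 n3 m = w"]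
      by simp
    then show ?thesis
      by (simp add: subst_poly_monomials coeff_sum)
  qed
  then show ?thesis
    by (simp add: semigroup_ideal_def poly_eq_iff)
qed

lemma keys_binomial:
  assumes "m \<noteq> m'"
  shows "Poly_Mapping.keys (monomial m - monomial m' :: 'k::field poly3) = {m, m'}"
  using assms by (auto simp: in_keys_iff lookup_minus lookup_single when_def split: if_splits)

lemma binomial_in_semigroup_ideal:
  assumes "m \<noteq> m'" "wt n1 n2 n3 m = wt n1 n2 n3 m'"
  shows "monomial m - monomial m' \<in> (semigroup_ideal n1 n2 n3 :: 'k::field poly3 set)"
proof -
  have "{k. k \<in> Poly_Mapping.keys (monomial m - monomial m' :: 'k poly3) \<and> wt n1 n2 n3 k = w} =
      (if w = wt n1 n2 n3 m then {m, m'} else {})" for w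
    using assms by (auto simp: keys_binomial)
  then show ?thesis
    using assms(1) by (auto simp: semigroup_ideal_iff lookup_minus lookup_single when_def)
qed

lemma initial_form_binomial:
  assumes "m \<noteq> m'" "mdeg m \<le> mdeg m'"
  shows "initial_form (monomial m - monomial m' :: 'k::field poly3) =
    (if mdeg m < mdeg m' then monomial m else monomial m - monomial m')"
proof -
  have "{k \<in> Poly_Mapping.keys (monomial m - monomial m' :: 'k poly3). mdeg k = mdeg m} =
      (if mdeg m < mdeg m' then {m} else {m, m'})"
    using assms by (auto simp: keys_binomial)
  moreover have "Min (mdeg ` Poly_Mapping.keys (monomial m - monomial m' :: 'k poly3)) = mdeg m"
    using assms by (simp add: keys_binomial)
  ultimately show ?thesis
    using assms(1)
    by (auto simp: initial_form_def hom_component_def lookup_minus lookup_single when_def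
        single_uminus)
qed

text \<open>The exponents \<open>m\<close> for which some \<open>x\<^sup>m - x\<^sup>m'\<close> in the toric ideal has initial form \<open>x\<^sup>m\<close>.\<close>
definition improvable :: "nat \<Rightarrow> nat \<Rightarrow> nat \<Rightarrow> mon set" where
  "improvable n1 n2 n3 = {m. \<exists>m'. wt n1 n2 n3 m' = wt n1 n2 n3 m \<and> mdeg m < mdeg m'}"

lemma improvable_add: "m \<in> improvable n1 n2 n3 \<Longrightarrow> t + m \<in> improvable n1 n2 n3"
proof -
  assume "m \<in> improvable n1 n2 n3"
  then obtain m' where "wt n1 n2 n3 m' = wt n1 n2 n3 m" "mdeg m < mdeg m'"
    by (auto simp: improvable_def)
  then show ?thesis
    by (auto simp: improvable_def wt_add mdeg_add intro!: exI[of _ "t + m'"])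
qed

text \<open>Two exponents of the same weight and the same degree differ by an integral multiple of
  \<open>(-hx, hy, -hz)\<close>. Orienting the pair by the exponent of \<open>y\<close> keeps the assumption in the natural numbers.\<close>
locale binomial_fibres =
  fixes n1 n2 n3 hx hy hz :: nat
  assumes hy_pos: "0 < hy" and hz_pos: "0 < hz"
    and h_deg: "hx + hz = hy"
    and h_wt: "n1 * hx + n3 * hz = n2 * hy"
    and fibre: "\<And>m m'. wt n1 n2 n3 m = wt n1 n2 n3 m' \<Longrightarrow> mdeg m = mdeg m' \<Longrightarrow>
      Poly_Mapping.lookup m' Y \<le> Poly_Mapping.lookup m Y \<Longrightarrow>
      \<exists>t s. m = t + xyz 0 (s * hy) 0 \<and> m' = t + xyz (s * hx) 0 (s * hz)"
begin

abbreviation "W \<equiv> wt n1 n2 n3"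

definition hbin :: "'k::field poly3" where
  "hbin = monomial (xyz 0 hy 0) - monomial (xyz hx 0 hz)"

lemma xyz_scale_power:
  "monomial (xyz 0 (s * hy) 0) = (monomial (xyz 0 hy 0) :: 'k::field poly3) ^ s"
  "monomial (xyz (s * hx) 0 (s * hz)) = (monomial (xyz hx 0 hz) :: 'k::field poly3) ^ s"
proof (induction s)
  case 0
  { case 1 show ?case by (simp add: xyz_def) next
    case 2 show ?case by (simp add: xyz_def) }
next
  case (Suc s)
  { case 1 show ?case unfolding power_Suc Suc.IH(1)[symmetric] mono_mult xyz_add by simp next
    case 2 show ?case unfolding power_Suc Suc.IH(2)[symmetric] mono_mult xyz_add by simp }
qed

text \<open>Along a fibre the difference of two monomials is a common factor times \<open>u^s - v^s\<close>, where \<open>u\<close> and \<open>v\<close>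
  are the terms of the binomial, and \<open>u - v\<close> divides \<open>u^s - v^s\<close>.\<close>
lemma fibre_binomial_in_ideal:
  assumes "W m = W m'" "mdeg m = mdeg m'" "hbin \<in> ideal_gen G"
  shows "monomial m - monomial m' \<in> ideal_gen (G :: 'k::field poly3 set)"
proof -
  have *: "monomial m - monomial m' \<in> ideal_gen G"
    if asm: "W m = W m'" "mdeg m = mdeg m'" "Poly_Mapping.lookup m' Y \<le> Poly_Mapping.lookup m Y" for m m'
  proof -
    from fibre[OF asm] obtain t s where ts: "m = t + xyz 0 (s * hy) 0" "m' = t + xyz (s * hx) 0 (s * hz)"
      by blast
    let ?u = "monomial (xyz 0 hy 0) :: 'k poly3" and ?v = "monomial (xyz hx 0 hz) :: 'k poly3"
    have "monomial m - monomial m' = monomial t * (?u ^ s - ?v ^ s)"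
      unfolding ts xyz_scale_power[symmetric] mono_mult right_diff_distrib ..
    also have "?u ^ s - ?v ^ s = (\<Sum>i<s. ?v ^ (s - Suc i) * ?u ^ i) * hbin"
      unfolding hbin_def power_diff_sumr2 by (rule mult.commute)
    finally have "monomial m - monomial m' = (monomial t * (\<Sum>i<s. ?v ^ (s - Suc i) * ?u ^ i)) * hbin"
      by (simp add: mult.assoc)
    then show ?thesis
      by (simp only: ideal_gen_mult[OF assms(3)])
  qed
  show ?thesis
  proof (cases "Poly_Mapping.lookup m' Y \<le> Poly_Mapping.lookup m Y")
    case True
    then show ?thesis using * assms(1,2) by blast
  next
    case False
    then have "monomial m' - monomial m \<in> ideal_gen G" using *[of m' m] assms(1,2) by simp
    from ideal_gen_mult[OF this, of "-1"] show ?thesis by simp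
  qed
qed

text \<open>The initial form splits into its weight components. If a monomial of weight \<open>w\<close> and larger degree
  occurs in \<open>f\<close>, all monomials of the component are improvable. Otherwise the component contains all terms
  of \<open>f\<close> of weight \<open>w\<close>; their coefficients add up to zero, so it is a combination of differences of
  monomials in one fibre.\<close>
lemma initial_form_in_ideal:
  fixes G :: "'k::field poly3 set"
  assumes f: "f \<in> semigroup_ideal n1 n2 n3"
    and hG: "hbin \<in> ideal_gen G"
    and D: "\<And>m. m \<in> improvable n1 n2 n3 \<Longrightarrow> monomial m \<in> ideal_gen G"
  shows "initial_form f \<in> ideal_gen G"
proof -
  define k where "k = Min (mdeg ` Poly_Mapping.keys f)"
  define K where "K = {m \<in> Poly_Mapping.keys f. mdeg m = k}"
  let ?c = "\<lambda>m. Poly_Mapping.single m (Poly_Mapping.lookup f m)"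
  have fin: "finite K" by (simp add: K_def)
  have "initial_form f = (\<Sum>m\<in>K. ?c m)"
    by (simp add: initial_form_def hom_component_def K_def k_def)
  also have "\<dots> = (\<Sum>w\<in>W ` K. \<Sum>m | m \<in> K \<and> W m = w. ?c m)"
    using sum.group[OF fin, of "W ` K" W ?c] fin by simp
  also have "\<dots> \<in> ideal_gen G"
  proof (rule ideal_gen_sum)
    fix w
    show "(\<Sum>m | m \<in> K \<and> W m = w. ?c m) \<in> ideal_gen G"
    proof (cases "\<exists>m'\<in>Poly_Mapping.keys f. W m' = w \<and> mdeg m' \<noteq> k")
      case True
      then obtain m' where m': "m' \<in> Poly_Mapping.keys f" "W m' = w" "mdeg m' \<noteq> k" by blast
      have "k \<le> mdeg m'" using m'(1) by (simp add: k_def)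
      with m' have "m \<in> improvable n1 n2 n3" if "m \<in> K" "W m = w" for m
        using that by (auto simp: improvable_def K_def intro!: exI[of _ m'])
      then show ?thesis
        using mono_in_ideal_gen[OF D, of _ 0] by (intro ideal_gen_sum) simp
    next
      case False
      then have eq: "{m. m \<in> K \<and> W m = w} = {m. m \<in> Poly_Mapping.keys f \<and> W m = w}"
        by (auto simp: K_def)
      show ?thesis
      proof (cases "{m. m \<in> K \<and> W m = w} = {}")
        case True
        show ?thesis unfolding True by (simp add: ideal_gen_zero)
      next
        case False
        then obtain m0 where m0: "m0 \<in> K" "W m0 = w" by blast
        \<comment> \<open>Subtract \<open>x\<^sup>m0\<close> from every monomial: the total correction is \<open>x\<^sup>m0\<close> times the sum of the
          coefficients, which is zero.\<close>
        have "(\<Sum>m | m \<in> K \<and> W m = w. ?c m) =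
            (\<Sum>m | m \<in> K \<and> W m = w. Poly_Mapping.single 0 (Poly_Mapping.lookup f m) * (monomial m - monomial m0))
            + (\<Sum>m | m \<in> K \<and> W m = w. Poly_Mapping.single m0 (Poly_Mapping.lookup f m))"
          by (simp add: right_diff_distrib mult_single sum_subtractf)
        also have "(\<Sum>m | m \<in> K \<and> W m = w. Poly_Mapping.single m0 (Poly_Mapping.lookup f m)) =
            Poly_Mapping.single m0 (\<Sum>m | m \<in> K \<and> W m = w. Poly_Mapping.lookup f m)"
          by (rule poly_mapping_eqI) (auto simp: lookup_sum lookup_single when_def)
        also have "\<dots> = 0"
          using f unfolding eq by (simp add: semigroup_ideal_iff)
        also have "(\<Sum>m | m \<in> K \<and> W m = w. Poly_Mapping.single 0 (Poly_Mapping.lookup f m) *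
             (monomial m - monomial m0)) + 0 \<in> ideal_gen G"
          using m0 unfolding add_0_right
          by (intro ideal_gen_sum ideal_gen_mult fibre_binomial_in_ideal hG) (auto simp: K_def)
        finally show ?thesis .
      qed
    qed
  qed
  finally show ?thesis .
qed

lemma h_keys_neq: "xyz 0 hy 0 \<noteq> xyz hx 0 hz"
  using hy_pos by (simp add: mon_eq_iff)

lemma initial_ideal_eq:
  "initial_form_ideal (semigroup_ideal n1 n2 n3 :: 'k::field poly3 set) =
     ideal_gen (monomial ` improvable n1 n2 n3 \<union> {hbin})"
  unfolding initial_form_ideal_def
proof (rule ideal_gen_eqI)
  show "{initial_form f |f. f \<in> semigroup_ideal n1 n2 n3 \<and> f \<noteq> 0} \<subseteq>
      ideal_gen (monomial ` improvable n1 n2 n3 \<union> {hbin :: 'k poly3})"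
    by (auto intro!: initial_form_in_ideal intro: ideal_gen_base)
next
  have nz: "monomial m - monomial m' \<noteq> (0 :: 'k poly3)" if "m \<noteq> m'" for m m'
    using keys_binomial[OF that, where 'k = 'k] by (metis insert_not_empty keys_zero)
  let ?J = "{initial_form f |f. f \<in> (semigroup_ideal n1 n2 n3 :: 'k poly3 set) \<and> f \<noteq> 0}"
  have "monomial m \<in> ideal_gen ?J" if "m \<in> improvable n1 n2 n3" for m
  proof -
    from that obtain m' where m': "W m' = W m" "mdeg m < mdeg m'"
      by (auto simp: improvable_def)
    then have "m \<noteq> m'" by auto
    with m' have "monomial m = initial_form (monomial m - monomial m' :: 'k poly3)"
      by (simp add: initial_form_binomial)
    with nz[OF \<open>m \<noteq> m'\<close>] binomial_in_semigroup_ideal[OF \<open>m \<noteq> m'\<close> m'(1)[symmetric], where 'k = 'k]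
    show ?thesis by (intro ideal_gen_base) blast
  qed
  moreover have "hbin \<in> ideal_gen ?J"
  proof -
    have "hbin = initial_form (hbin :: 'k poly3)"
      using h_deg unfolding hbin_def
      by (subst initial_form_binomial[OF h_keys_neq]) (simp_all add: mdeg_eq)
    with nz[OF h_keys_neq] show ?thesis
      using binomial_in_semigroup_ideal[OF h_keys_neq, where 'k = 'k and ?n1.0 = n1 and ?n2.0 = n2 and ?n3.0 = n3] h_wt
      unfolding hbin_def by (intro ideal_gen_base) (auto simp: wt_def)
  qed
  ultimately show "monomial ` improvable n1 n2 n3 \<union> {hbin :: 'k poly3} \<subseteq> ideal_gen ?J"
    by auto
qed

end

section \<open>Leading monomials\<close>

lemma lead_mon_props:
  assumes "f \<noteq> (0 :: 'k::field poly3)"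
  shows "lead_mon f \<in> Poly_Mapping.keys f"
    and "m \<in> Poly_Mapping.keys f \<Longrightarrow> m \<noteq> lead_mon f \<Longrightarrow> revlex_less m (lead_mon f)"
proof -
  have irrefl: "\<not> revlex_less m m" for m by (simp add: revlex_less_def)
  have trans: "revlex_less m m' \<Longrightarrow> revlex_less m' m'' \<Longrightarrow> revlex_less m m''" for m m' m''
    by (auto simp: revlex_less_def)
  have total: "m \<noteq> m' \<Longrightarrow> revlex_less m m' \<or> revlex_less m' m" for m m'
    by (auto simp: revlex_less_def mdeg_eq mon_eq_iff)
  have "\<exists>m\<in>K. \<forall>m'\<in>K. m' \<noteq> m \<longrightarrow> revlex_less m' m" if "finite K" "K \<noteq> {}" for K
    using that
  proof (induction rule: finite_ne_induct)
    case (insert x F)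
    then obtain m where m: "m \<in> F" "\<forall>m'\<in>F. m' \<noteq> m \<longrightarrow> revlex_less m' m" by blast
    show ?case
    proof (cases "revlex_less m x")
      case True
      with m trans show ?thesis by (intro bexI[of _ x]) auto
    next
      case False
      with m total[of m x] show ?thesis by (intro bexI[of _ m]) auto
    qed
  qed simp
  from this[of "Poly_Mapping.keys f"] assms obtain m where m: "m \<in> Poly_Mapping.keys f"
    "\<forall>m'\<in>Poly_Mapping.keys f. m' \<noteq> m \<longrightarrow> revlex_less m' m"
    by auto
  have "lead_mon f = m"
    unfolding lead_mon_def
  proof (rule the_equality)
    fix m' assume m': "m' \<in> Poly_Mapping.keys f \<and>
      (\<forall>x\<in>Poly_Mapping.keys f. x \<noteq> m' \<longrightarrow> revlex_less x m')"
    show "m' = m"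
    proof (rule ccontr)
      assume "m' \<noteq> m"
      with m m' have "revlex_less m' m" "revlex_less m m'" by auto
      with trans irrefl show False by blast
    qed
  qed (use m in blast)
  with m show "lead_mon f \<in> Poly_Mapping.keys f"
    and "m \<in> Poly_Mapping.keys f \<Longrightarrow> m \<noteq> lead_mon f \<Longrightarrow> revlex_less m (lead_mon f)" for m
    by auto
qed

lemma lead_mon_mono: "lead_mon (monomial m :: 'k::field poly3) = m"
proof -
  have "(monomial m :: 'k poly3) \<noteq> 0"
    by (metis keys_single keys_zero insert_not_empty zero_neq_one)
  from lead_mon_props(1)[OF this] show ?thesis by simp
qed

lemma improvable_cong:
  "wt n1 n2 n3 m = wt n1 n2 n3 m' \<Longrightarrow> mdeg m = mdeg m' \<Longrightarrow>
    m \<in> improvable n1 n2 n3 \<longleftrightarrow> m' \<in> improvable n1 n2 n3"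
  by (simp add: improvable_def)

context binomial_fibres
begin

text \<open>On a fibre without improvable exponents this linear form kills the whole initial ideal, and so
  detects that an element with a term in the fibre must have a second one.\<close>
definition fibre_sum :: "nat \<Rightarrow> nat \<Rightarrow> 'k::field poly3 \<Rightarrow> 'k" where
  "fibre_sum w k f = (\<Sum>m\<in>Poly_Mapping.keys f.
     if W m = w \<and> mdeg m = k then Poly_Mapping.lookup f m else 0)"

lemma fibre_sum_add: "fibre_sum w k (f + g) = fibre_sum w k f + fibre_sum w k g"
  unfolding fibre_sum_def
  by (rule setsum_keys_plus_distrib[of "\<lambda>m x. if W m = w \<and> mdeg m = k then x else 0"]) auto

lemma fibre_sum_single:
  "fibre_sum w k (Poly_Mapping.single m c) = (if W m = w \<and> mdeg m = k then c else 0)"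
  by (simp add: fibre_sum_def)

lemma fibre_sum_initial_ideal:
  assumes "f \<in> ideal_gen (monomial ` improvable n1 n2 n3 \<union> {hbin :: 'k::field poly3})"
    and "m \<notin> improvable n1 n2 n3"
  shows "fibre_sum (W m) (mdeg m) f = 0"
  using assms(1)
proof (induction rule: ideal_gen_induct)
  case zero
  then show ?case by (simp add: fibre_sum_def)
next
  case (add f g t c)
  have "fibre_sum (W m) (mdeg m) (Poly_Mapping.single t c * g) = 0"
  proof (cases "g = hbin")
    case True
    have "Poly_Mapping.single t c * g =
        Poly_Mapping.single (t + xyz 0 hy 0) c + Poly_Mapping.single (t + xyz hx 0 hz) (- c)"
      by (simp add: True hbin_def right_diff_distrib mult_single single_uminus)
    moreover have "W (t + xyz 0 hy 0) = W (t + xyz hx 0 hz)" "mdeg (t + xyz 0 hy 0) = mdeg (t + xyz hx 0 hz)"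
      using h_wt h_deg by (simp_all add: wt_add mdeg_add) (simp_all add: wt_def mdeg_eq)
    ultimately show ?thesis by (simp add: fibre_sum_add fibre_sum_single)
  next
    case False
    with add.hyps obtain e where e: "g = monomial e" "e \<in> improvable n1 n2 n3" by auto
    have "\<not> (W (t + e) = W m \<and> mdeg (t + e) = mdeg m)"
      using improvable_add[OF e(2), of t] assms(2) improvable_cong by blast
    then show ?thesis by (auto simp: e(1) mult_single fibre_sum_single)
  qed
  then show ?case using add.IH by (simp add: fibre_sum_add)
qed

text \<open>If the leading exponent \<open>m\<close> is not improvable, the coefficients of \<open>f\<close> in the fibre of \<open>m\<close> add up to
  zero, so a further exponent \<open>m'\<close> of \<open>f\<close> lies in it. The order prefers less \<open>z\<close>, so moving from \<open>m'\<close> up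
  to \<open>m\<close> along the fibre adds a positive multiple of \<open>hy\<close> to the exponent of \<open>y\<close>.\<close>
lemma lead_mon_initial_ideal:
  assumes "f \<in> ideal_gen (monomial ` improvable n1 n2 n3 \<union> {hbin :: 'k::field poly3})" "f \<noteq> 0"
  shows "lead_mon f \<in> improvable n1 n2 n3 \<or> hy \<le> Poly_Mapping.lookup (lead_mon f) Y"
proof (rule disjCI)
  let ?m = "lead_mon f"
  assume neg: "\<not> hy \<le> Poly_Mapping.lookup ?m Y"
  show "?m \<in> improvable n1 n2 n3"
  proof (rule ccontr)
    assume "?m \<notin> improvable n1 n2 n3"
    then have "fibre_sum (W ?m) (mdeg ?m) f = 0" by (rule fibre_sum_initial_ideal[OF assms(1)])
    moreover have "Poly_Mapping.lookup f ?m \<noteq> 0"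
      using lead_mon_props(1)[OF assms(2)] by (simp add: in_keys_iff)
    moreover have "fibre_sum (W ?m) (mdeg ?m) f = Poly_Mapping.lookup f ?m"
      if "\<And>m'. m' \<in> Poly_Mapping.keys f \<Longrightarrow> W m' = W ?m \<Longrightarrow> mdeg m' = mdeg ?m \<Longrightarrow> m' = ?m"
    proof -
      have "fibre_sum (W ?m) (mdeg ?m) f =
          (\<Sum>m\<in>Poly_Mapping.keys f. if m = ?m then Poly_Mapping.lookup f m else 0)"
        unfolding fibre_sum_def using that by (intro sum.cong) auto
      then show ?thesis using lead_mon_props(1)[OF assms(2)] by simp
    qed
    ultimately obtain m' where m': "m' \<in> Poly_Mapping.keys f" "m' \<noteq> ?m" "W m' = W ?m" "mdeg m' = mdeg ?m"
      by metis
    have less: "revlex_less m' ?m" by (rule lead_mon_props(2)[OF assms(2) m'(1,2)])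
    show False
    proof (cases "Poly_Mapping.lookup m' Y \<le> Poly_Mapping.lookup ?m Y")
      case True
      from fibre[OF m'(3)[symmetric] m'(4)[symmetric] True] obtain t s where
        ts: "?m = t + xyz 0 (s * hy) 0" "m' = t + xyz (s * hx) 0 (s * hz)" by blast
      have "s \<noteq> 0" using m'(2) ts by (auto simp: mon_eq_iff lookup_add)
      then have "hy \<le> s * hy" by simp
      also have "\<dots> \<le> Poly_Mapping.lookup ?m Y" by (subst ts(1)) (simp add: lookup_add)
      finally show False using neg by simp
    next
      case False
      then obtain t s where
        ts: "m' = t + xyz 0 (s * hy) 0" "?m = t + xyz (s * hx) 0 (s * hz)"
        using fibre[OF m'(3,4)] by auto
      have "s \<noteq> 0" using m'(2) ts by (auto simp: mon_eq_iff lookup_add)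
      then have "Poly_Mapping.lookup m' Z < Poly_Mapping.lookup ?m Z"
        using hz_pos by (subst ts(1), subst ts(2)) (simp add: lookup_add)
      then show False using less m'(4) by (simp add: revlex_less_def)
    qed
  qed
qed

lemma lead_mon_hbin: "lead_mon (hbin :: 'k::field poly3) = xyz 0 hy 0"
proof (rule ccontr)
  assume neq: "lead_mon (hbin :: 'k poly3) \<noteq> xyz 0 hy 0"
  have keys: "Poly_Mapping.keys (hbin :: 'k poly3) = {xyz 0 hy 0, xyz hx 0 hz}"
    unfolding hbin_def by (rule keys_binomial[OF h_keys_neq])
  then have nz: "(hbin :: 'k poly3) \<noteq> 0" by auto
  have "lead_mon (hbin :: 'k poly3) = xyz hx 0 hz"
    using lead_mon_props(1)[OF nz] neq keys by auto
  moreover have "revlex_less (xyz 0 hy 0) (lead_mon (hbin :: 'k poly3))"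
    using lead_mon_props(2)[OF nz, of "xyz 0 hy 0"] neq keys by auto
  ultimately show False using hz_pos h_deg by (simp add: revlex_less_def mdeg_eq)
qed

text \<open>The bound on the exponent of \<open>x\<close> says that no monomial generator is divisible by the term of the
  binomial that contains \<open>x\<close>. Hence a monomial \<open>x\<^sup>e\<close> with \<open>e\<close> in \<open>E\<close>, if its \<open>y\<close>-exponent is less than
  \<open>hy\<close>, can only arise from the monomials in \<open>G\<close>, and no leading monomial is lost although \<open>G\<close> need not
  contain all of \<open>E\<close>.\<close>
lemma groebner_basis_of_generators:
  fixes G :: "'k::field poly3 set"
  assumes gens: "G \<subseteq> monomial ` E \<union> {hbin}" "finite E"
    and I: "ideal_gen G = ideal_gen (monomial ` improvable n1 n2 n3 \<union> {hbin})"
    and E: "E \<subseteq> improvable n1 n2 n3"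
    and cover: "\<And>m. m \<in> improvable n1 n2 n3 \<Longrightarrow> \<exists>e\<in>E. \<exists>t. m = t + e"
    and E_small: "\<And>e. e \<in> E \<Longrightarrow> Poly_Mapping.lookup e X < hx"
  shows "groebner_basis G (ideal_gen G)"
  unfolding groebner_basis_def
proof (intro conjI)
  show "finite G" using gens finite_subset by blast
  show "G \<subseteq> ideal_gen G" by (auto intro: ideal_gen_base)
  let ?lm = "\<lambda>F :: 'k poly3 set. {monomial (lead_mon f) :: 'k poly3 | f. f \<in> F \<and> f \<noteq> 0}"
  have mono_nz: "monomial m \<noteq> (0 :: 'k poly3)" for m
    by (metis keys_single keys_zero insert_not_empty zero_neq_one)
  have keys_h: "Poly_Mapping.keys (hbin :: 'k poly3) = {xyz 0 hy 0, xyz hx 0 hz}"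
    unfolding hbin_def by (rule keys_binomial[OF h_keys_neq])
  then have h_nz: "(hbin :: 'k poly3) \<noteq> 0" by auto
  have monoG: "monomial e \<in> lead_mon_ideal G" if "monomial e \<in> G" for e
    unfolding lead_mon_ideal_def
    by (intro ideal_gen_base CollectI exI[of _ "monomial e"]) (simp add: that mono_nz lead_mon_mono)
  have hG: "monomial m \<in> lead_mon_ideal G" if "hbin \<in> G" "hy \<le> Poly_Mapping.lookup m Y" for m
  proof -
    have "monomial (xyz 0 hy 0) \<in> lead_mon_ideal G"
      unfolding lead_mon_ideal_def
      by (intro ideal_gen_base CollectI exI[of _ "hbin"]) (simp add: that h_nz lead_mon_hbin)
    then have "monomial (xyz (Poly_Mapping.lookup m X) (Poly_Mapping.lookup m Y) (Poly_Mapping.lookup m Z))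
        \<in> lead_mon_ideal G"
      unfolding lead_mon_ideal_def by (rule mono_in_ideal_gen') (use that(2) in auto)
    moreover have "xyz (Poly_Mapping.lookup m X) (Poly_Mapping.lookup m Y) (Poly_Mapping.lookup m Z) = m"
      by (simp add: mon_eq_iff)
    ultimately show ?thesis by simp
  qed
  have "monomial (lead_mon f) \<in> lead_mon_ideal G" if f: "f \<in> ideal_gen G" "f \<noteq> 0" for f
  proof -
    let ?m = "lead_mon f"
    show ?thesis
    proof (cases "hbin \<in> G")
      case False
      obtain g e t where g: "g \<in> G" "e \<in> Poly_Mapping.keys g" "?m = t + e"
        using key_in_ideal_gen[OF f(1) lead_mon_props(1)[OF f(2)]] by metis
      with gens False have "g = monomial e" by auto
      with g(1) have "monomial e \<in> lead_mon_ideal G" using monoG by simp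
      from mono_in_ideal_gen[OF this[unfolded lead_mon_ideal_def], of t 1] show ?thesis
        unfolding lead_mon_ideal_def g(3) .
    next
      case True
      show ?thesis
      proof (cases "hy \<le> Poly_Mapping.lookup ?m Y")
        case False
        with lead_mon_initial_ideal f I have "?m \<in> improvable n1 n2 n3" by metis
        then obtain e t where e: "e \<in> E" "?m = t + e" using cover by blast
        have "hy > Poly_Mapping.lookup e Y" using False e(2) by (simp add: lookup_add)
        moreover have "monomial e \<in> ideal_gen G" using e(1) E unfolding I by (auto intro: ideal_gen_base)
        then obtain g e' t' where g: "g \<in> G" "e' \<in> Poly_Mapping.keys g" "e = t' + e'"
          using key_in_ideal_gen[of "monomial e" G e] by auto
        moreover have "g \<noteq> hbin"
        proof
          assume "g = hbin"
          with g(2) keys_h have "e' = xyz 0 hy 0 \<or> e' = xyz hx 0 hz" by auto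
          then have "hy \<le> Poly_Mapping.lookup e Y \<or> hx \<le> Poly_Mapping.lookup e X"
            unfolding g(3) by (auto simp: lookup_add)
          with \<open>hy > Poly_Mapping.lookup e Y\<close> E_small[OF e(1)] show False by simp
        qed
        ultimately have "monomial e' \<in> G" using gens by auto
        from mono_in_ideal_gen[OF monoG[OF this, unfolded lead_mon_ideal_def], of "t + t'" 1]
        show ?thesis unfolding lead_mon_ideal_def e(2) g(3) by (simp add: add.assoc)
      qed (use hG True in blast)
    qed
  qed
  then have "?lm (ideal_gen G) \<subseteq> lead_mon_ideal G" by auto
  then have "lead_mon_ideal (ideal_gen G) \<subseteq> lead_mon_ideal G"
    unfolding lead_mon_ideal_def by (rule ideal_gen_subset)
  moreover have "lead_mon_ideal G \<subseteq> lead_mon_ideal (ideal_gen G)"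
    unfolding lead_mon_ideal_def by (rule ideal_gen_mono) (auto intro: ideal_gen_base)
  ultimately show "lead_mon_ideal G = lead_mon_ideal (ideal_gen G)" by (rule subset_antisym[rotated])
qed

end

lemma mu_le_card:
  assumes "finite G" "ideal_gen G = I" shows "mu I \<le> card G"
  unfolding mu_def using assms by (intro Least_le) blast

section \<open>Staircases\<close>

text \<open>Consider the lattice points \<open>(s, t)\<close> with \<open>s q < t p\<close> and the value \<open>t P - s R\<close>, which is
  positive on them because \<open>q / p \<ge> R / P\<close>. The points of interest are the steps: for given \<open>s\<close> the
  smallest admissible \<open>t\<close>, provided that its value is less than all values at smaller \<open>s\<close>. The set \<open>A\<close> is
  the case \<open>(s, t) = (\<beta>, \<alpha>)\<close> with \<open>(p, q, P, R) = (r13, r23, r13, r23)\<close>, and \<open>B\<close> is the case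
  \<open>(s, t) = (\<gamma>, \<sigma>)\<close> with \<open>(p, q, P, R) = (\<delta>2, \<delta>1, r23, r13)\<close>. The value is the exponent of \<open>z\<close>.\<close>
locale staircase =
  fixes p q P R :: int
  assumes pos: "0 < p" "0 < q" "0 < P" "0 < R"
    and slope: "R * p \<le> q * P"
begin

definition adm :: "nat \<Rightarrow> nat \<Rightarrow> bool" where
  "adm s t \<longleftrightarrow> int s * q < int t * p"

definition val :: "nat \<Rightarrow> nat \<Rightarrow> int" where
  "val s t = int t * P - int s * R"

definition top :: "nat \<Rightarrow> nat" where
  "top s = (LEAST t. adm s t)"

definition step :: "nat \<Rightarrow> bool" where
  "step s \<longleftrightarrow> (\<forall>s'<s. val s (top s) < val s' (top s'))"

lemma adm_exists: "\<exists>t. adm s t"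
proof
  have "int s * q * 1 \<le> int s * q * p" using pos by (intro mult_left_mono) auto
  moreover have "int (nat (int s * q + 1)) = int s * q + 1" using pos by simp
  ultimately show "adm s (nat (int s * q + 1))"
    using pos unfolding adm_def by (simp add: distrib_right)
qed

lemma adm_mono: "adm s t \<Longrightarrow> t \<le> t' \<Longrightarrow> adm s t'"
  using pos unfolding adm_def by (meson less_le_trans mult_right_mono of_nat_mono order_less_imp_le)

lemma adm_iff: "adm s t \<longleftrightarrow> top s \<le> t"
  using adm_exists[of s] adm_mono unfolding top_def by (meson LeastI_ex Least_le)

lemma adm_top: "adm s (top s)"
  by (simp add: adm_iff)

lemma adm_antimono: "adm s t \<Longrightarrow> s' \<le> s \<Longrightarrow> adm s' t"
  using pos unfolding adm_def
  by (meson le_less_trans mult_right_mono of_nat_mono order_less_imp_le)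

lemma top_mono: "s \<le> s' \<Longrightarrow> top s \<le> top s'"
  using adm_antimono[OF adm_top] adm_iff by blast

lemma top_0: "top 0 = 1"
proof -
  have "adm 0 t \<longleftrightarrow> 1 \<le> t" for t
    using pos by (simp add: adm_def zero_less_mult_iff) linarith
  then show ?thesis by (metis adm_iff le_refl le_antisym)
qed

lemma val_mono: "t \<le> t' \<Longrightarrow> val s t \<le> val s t'"
  using pos by (simp add: val_def mult_right_mono)

lemma val_pos:
  assumes "adm s t" shows "0 < val s t"
proof -
  have "int s * (R * p) \<le> int s * (q * P)"
    using slope by (intro mult_left_mono) auto
  moreover have "int s * q * P < int t * p * P"
    using assms pos unfolding adm_def by (intro mult_strict_right_mono) auto
  ultimately have "0 < p * val s t"
    by (simp add: val_def algebra_simps)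
  then show ?thesis using pos by (simp add: zero_less_mult_iff)
qed

lemma step_0: "step 0"
  by (simp add: step_def)

lemma step_less: "step s' \<Longrightarrow> s < s' \<Longrightarrow> val s' (top s') < val s (top s)"
  by (simp add: step_def)

lemma step_val_bounds:
  assumes "step s" shows "val s (top s) \<in> {1..P}"
proof -
  have "val s (top s) \<le> val 0 (top 0)"
    using step_less[OF assms, of 0] by (cases "s = 0") auto
  moreover have "val 0 (top 0) = P" by (simp add: top_0 val_def)
  ultimately show ?thesis using val_pos[OF adm_top, of s] by simp
qed

lemma inj_on_val: "inj_on (\<lambda>s. val s (top s)) {s. step s}"
  by (rule linorder_inj_onI) (auto dest: step_less)

lemma finite_steps: "finite {s. step s}"
proof (rule finite_imageD[OF _ inj_on_val])
  show "finite ((\<lambda>s. val s (top s)) ` {s. step s})"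
    by (rule finite_subset[of _ "{1..P}"]) (use step_val_bounds in auto)
qed

text \<open>Every admissible point dominates a step in both coordinates and in its value: take the smallest value
  over all \<open>s' \<le> s\<close>, at the first place where it is attained.\<close>
lemma step_below:
  assumes "adm s t"
  obtains s' where "step s'" "s' \<le> s" "top s' \<le> t" "val s' (top s') \<le> val s t"
proof -
  define v where "v = (\<lambda>s. val s (top s))"
  define w where "w = Min (v ` {..s})"
  define s' where "s' = (LEAST x. x \<le> s \<and> v x = w)"
  have "w \<in> v ` {..s}" unfolding w_def by (intro Min_in) auto
  then have ex: "\<exists>x. x \<le> s \<and> v x = w" by auto
  have s': "s' \<le> s" "v s' = w"
    using LeastI_ex[OF ex] unfolding s'_def by auto
  have "w < v x" if "x < s'" for x
  proof -
    have "x \<le> s" using that s' by simp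
    then have "w \<le> v x" unfolding w_def by (intro Min_le) auto
    moreover have "v x \<noteq> w" using not_less_Least[OF that[unfolded s'_def]] \<open>x \<le> s\<close> by blast
    ultimately show ?thesis by simp
  qed
  then have "step s'" using s' by (simp add: step_def v_def)
  moreover have "top s' \<le> t" using top_mono[OF s'(1)] assms adm_iff by fastforce
  moreover have "v s' \<le> val s t"
  proof -
    have "w \<le> v s" unfolding w_def by (intro Min_le) auto
    also have "\<dots> \<le> val s t" using assms by (simp add: v_def adm_iff val_mono)
    finally show ?thesis using s' by simp
  qed
  ultimately show ?thesis using that s'(1) by (simp add: v_def)
qed

definition solutions :: "nat \<Rightarrow> nat set" where
  "solutions s0 = {s. s0 < s \<and> val s (top s) < val s0 (top s0)}"

text \<open>The recursion that defines the two sequences, in terms of \<open>s\<close> alone, as \<open>t\<close> is always \<open>top s\<close>.\<close>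
primrec walk :: "nat \<Rightarrow> nat option" where
  "walk 0 = Some 0"
| "walk (Suc i) = Option.bind (walk i)
     (\<lambda>s. if solutions s = {} then None else Some (LEAST s'. s' \<in> solutions s))"

lemma walk_Suc_Some:
  assumes "walk (Suc i) = Some s'"
  obtains s where "walk i = Some s" "s' \<in> solutions s" "\<And>x. x \<in> solutions s \<Longrightarrow> s' \<le> x"
proof -
  from assms obtain s where s: "walk i = Some s" "solutions s \<noteq> {}" "s' = (LEAST s'. s' \<in> solutions s)"
    by (auto simp: bind_eq_Some_conv split: if_splits)
  from s(2) have "\<exists>x. x \<in> solutions s" by auto
  from LeastI_ex[OF this] have "s' \<in> solutions s" unfolding s(3) .
  with s(1,3) show ?thesis using that by (simp add: Least_le)
qed

lemma walk_step: "walk i = Some s \<Longrightarrow> step s"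
proof (induction i arbitrary: s)
  case 0
  then show ?case using step_0 by simp
next
  case (Suc i s')
  then obtain s where s: "walk i = Some s" "s' \<in> solutions s" "\<And>x. x \<in> solutions s \<Longrightarrow> s' \<le> x"
    using walk_Suc_Some by metis
  note st = Suc.IH[OF s(1)]
  show ?case unfolding step_def
  proof (intro allI impI)
    fix x assume x: "x < s'"
    have lt: "val s' (top s') < val s (top s)" using s(2) by (simp add: solutions_def)
    consider "x < s" | "x = s" | "s < x" by linarith
    then show "val s' (top s') < val x (top x)"
    proof cases
      case 1
      with step_less[OF st] lt show ?thesis by fastforce
    next
      case 3
      with s(3)[of x] x have "x \<notin> solutions s" by auto
      with 3 lt show ?thesis by (auto simp: solutions_def)
    qed (use lt in simp)
  qed
qed

lemma walk_ge: "walk i = Some s \<Longrightarrow> i \<le> s"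
proof (induction i arbitrary: s)
  case (Suc i s')
  then obtain s where "walk i = Some s" "s' \<in> solutions s" by (metis walk_Suc_Some)
  with Suc.IH[of s] show ?case by (simp add: solutions_def)
qed simp

lemma walk_prefix: "walk j = Some s \<Longrightarrow> i \<le> j \<Longrightarrow> \<exists>s'\<le>s. walk i = Some s'"
proof (induction j arbitrary: s)
  case (Suc j s')
  show ?case
  proof (cases "i = Suc j")
    case False
    from Suc.prems obtain s where s: "walk j = Some s" "s' \<in> solutions s" by (metis walk_Suc_Some)
    with Suc.IH[of s] Suc.prems False obtain x where "x \<le> s" "walk i = Some x" by auto
    with s(2) show ?thesis by (auto simp: solutions_def intro!: exI[of _ x])
  qed (use Suc.prems in auto)
qed simp

text \<open>A step that is passed over by the sequence would itself be a solution after the last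
  entry before it.\<close>
lemma step_in_walk:
  assumes "step s" shows "\<exists>i. walk i = Some s"
proof -
  define I where "I = {i. \<exists>x\<le>s. walk i = Some x}"
  have fin: "finite I"
    by (rule finite_subset[of _ "{..s}"]) (auto simp: I_def dest: walk_ge)
  have "0 \<in> I" by (simp add: I_def)
  then have "Max I \<in> I" using fin by (intro Max_in) auto
  then obtain x where x: "x \<le> s" "walk (Max I) = Some x" by (auto simp: I_def)
  have "x = s"
  proof (rule ccontr)
    assume "x \<noteq> s"
    then have mem: "s \<in> solutions x" using x step_less[OF assms, of x] by (simp add: solutions_def)
    then have "walk (Suc (Max I)) = Some (LEAST s'. s' \<in> solutions x)" using x(2) by auto
    moreover have "(LEAST s'. s' \<in> solutions x) \<le> s" using mem by (rule Least_le)
    ultimately have "Suc (Max I) \<in> I" by (auto simp: I_def)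
    then show False using Max_ge[OF fin] by fastforce
  qed
  then show ?thesis using x by blast
qed

lemma walk_stops: "\<exists>N. \<forall>i. walk i \<noteq> None \<longrightarrow> i \<le> N"
proof -
  obtain N where N: "\<And>s. step s \<Longrightarrow> s \<le> N"
    using finite_steps by (auto simp: finite_nat_set_iff_bounded_le)
  then show ?thesis using walk_ge walk_step by (intro exI[of _ N]) fastforce
qed

text \<open>If a system has a solution at \<open>s'\<close>, then \<open>top s'\<close> is one as well, since lowering \<open>t\<close> only lowers
  the value.\<close>
lemma least_solution_eq:
  "(LEAST s'. \<exists>t. s' > s \<and> adm s' t \<and> val s' t < val s (top s)) = (LEAST s'. s' \<in> solutions s)"
  "(\<exists>s' t. s' > s \<and> adm s' t \<and> val s' t < val s (top s)) \<longleftrightarrow> solutions s \<noteq> {}"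
proof -
  have "(\<exists>t. s' > s \<and> adm s' t \<and> val s' t < val s (top s)) \<longleftrightarrow> s' \<in> solutions s" for s'
    using adm_top[of s'] val_mono[of "top s'" _ s'] adm_iff[of s']
    by (auto simp: solutions_def) (meson le_less_trans)
  then show "(LEAST s'. \<exists>t. s' > s \<and> adm s' t \<and> val s' t < val s (top s)) = (LEAST s'. s' \<in> solutions s)"
    "(\<exists>s' t. s' > s \<and> adm s' t \<and> val s' t < val s (top s)) \<longleftrightarrow> solutions s \<noteq> {}"
    by auto
qed

lemma phi_eq_top: "phi (real_of_int q / real_of_int p) s = top s"
proof -
  define x where "x = real_of_int q / real_of_int p * real s"
  have x0: "0 \<le> x" using pos by (simp add: x_def)
  have adm_x: "adm s t \<longleftrightarrow> x < real t" for t
  proof -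
    have "x < real t \<longleftrightarrow> real_of_int (int s * q) < real_of_int (int t * p)"
      using pos by (simp add: x_def field_simps)
    then show ?thesis unfolding adm_def of_int_less_iff by simp
  qed
  have phi: "phi (real_of_int q / real_of_int p) s = (if x \<in> \<nat> then nat \<lfloor>x\<rfloor> + 1 else nat \<lceil>x\<rceil>)"
    by (simp only: phi_def x_def)
  have "phi (real_of_int q / real_of_int p) s \<le> t \<longleftrightarrow> x < real t" for t
  proof (cases "x \<in> \<nat>")
    case True
    then obtain n where "x = real n" by (auto elim: Nats_cases)
    then show ?thesis by (auto simp: phi)
  next
    case False
    then have "x \<noteq> real t" by auto
    with False x0 show ?thesis
      by (auto simp: phi nat_le_iff ceiling_le_iff)
  qed
  then show ?thesis using adm_x adm_iff by (metis le_refl le_antisym)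
qed

end

text \<open>The second entries of the sequence increase strictly, so cutting it at the last index with
  \<open>\<beta> < \<epsilon>\<close> keeps exactly the steps with \<open>\<beta> < \<epsilon>\<close>; that index exists because an index never
  exceeds its entry.\<close>
lemma A_set_eq_steps:
  assumes "0 < r13" "0 < r23" "0 < \<epsilon>"
  shows "A_set r13 r23 \<epsilon> = (\<lambda>s. (staircase.top (int r13) (int r23) s, s)) `
    {s. staircase.step (int r13) (int r23) (int r13) (int r23) s \<and> s < \<epsilon>}"
proof -
  interpret staircase "int r13" "int r23" "int r13" "int r23"
    using assms by unfold_locales auto
  have sol: "A_solutions r13 r23 (top s, s) = {(\<alpha>, \<beta>). \<beta> > s \<and> adm \<beta> \<alpha> \<and> val \<beta> \<alpha> < val s (top s)}" for s
    by (auto simp: A_solutions_def adm_def val_def)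
  have phi: "phi (real r23 / real r13) s = top s" for s
    using phi_eq_top[of s] by simp
  have nxt: "A_next r13 r23 (top s, s) = (if solutions s = {} then None
      else let s' = LEAST s'. s' \<in> solutions s in Some (top s', s'))" for s
  proof -
    have "A_solutions r13 r23 (top s, s) = {} \<longleftrightarrow> solutions s = {}"
      using least_solution_eq(2)[of s] unfolding sol by auto
    moreover have "(LEAST \<beta>. \<exists>\<alpha>. (\<alpha>, \<beta>) \<in> A_solutions r13 r23 (top s, s)) = (LEAST s'. s' \<in> solutions s)"
      using least_solution_eq(1)[of s] unfolding sol by simp
    ultimately show ?thesis by (simp add: A_next_def phi Let_def)
  qed
  have seq: "A_seq r13 r23 i = map_option (\<lambda>s. (top s, s)) (walk i)" for i
  proof (induction i)
    case (Suc i)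
    then show ?case by (cases "walk i") (simp_all add: nxt Let_def)
  qed (simp add: top_0)
  define T where "T = {i. \<exists>s<\<epsilon>. walk i = Some s}"
  define t where "t = (GREATEST i. \<exists>\<alpha> \<beta>. A_seq r13 r23 i = Some (\<alpha>, \<beta>) \<and> \<beta> < \<epsilon>)"
  have t: "t = (GREATEST i. i \<in> T)"
    unfolding t_def T_def seq by (rule arg_cong[where f = Greatest]) (auto simp: fun_eq_iff)
  have bound: "i \<le> \<epsilon>" if "i \<in> T" for i using that walk_ge by (fastforce simp: T_def)
  have "0 \<in> T" using assms by (simp add: T_def)
  then have "t \<in> T" unfolding t by (rule GreatestI_nat) (rule bound)
  then obtain x where x: "walk t = Some x" "x < \<epsilon>" by (auto simp: T_def)
  have "(\<exists>i\<le>t. walk i = Some s) \<longleftrightarrow> step s \<and> s < \<epsilon>" for s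
  proof
    assume "\<exists>i\<le>t. walk i = Some s"
    with x walk_prefix[OF x(1)] walk_step show "step s \<and> s < \<epsilon>" by fastforce
  next
    assume s: "step s \<and> s < \<epsilon>"
    then obtain i where i: "walk i = Some s" using step_in_walk by blast
    with s have "i \<in> T" by (auto simp: T_def)
    then have "i \<le> t" unfolding t by (rule Greatest_le_nat) (rule bound)
    with i show "\<exists>i\<le>t. walk i = Some s" by blast
  qed
  then have "{p. \<exists>i\<le>t. A_seq r13 r23 i = Some p} = (\<lambda>s. (top s, s)) ` {s. step s \<and> s < \<epsilon>}"
    unfolding seq by (auto simp: image_iff)
  then show ?thesis unfolding A_set_def Let_def t_def .
qed

text \<open>No cut is made here: the values of the steps are distinct numbers in a bounded interval, so the
  sequence stops.\<close>
lemma B_set_eq_steps: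
  assumes "0 < r13" "0 < r23" "0 < \<delta>1" "0 < \<delta>2" "\<delta>2 * int r13 < \<delta>1 * int r23"
  shows "B_set r13 r23 \<delta>1 \<delta>2 = (\<lambda>s. (s, staircase.top \<delta>2 \<delta>1 s)) `
    {s. staircase.step \<delta>2 \<delta>1 (int r23) (int r13) s}"
proof -
  interpret staircase \<delta>2 \<delta>1 "int r23" "int r13"
    using assms by unfold_locales (auto simp: mult.commute)
  have sol: "B_solutions r13 r23 \<delta>1 \<delta>2 (s, top s) =
      {(\<gamma>, \<sigma>). \<gamma> > s \<and> adm \<gamma> \<sigma> \<and> val \<gamma> \<sigma> < val s (top s)}" for s
    by (auto simp: B_solutions_def adm_def val_def)
  have phi: "phi (real_of_int \<delta>1 / real_of_int \<delta>2) s = top s" for s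
    by (rule phi_eq_top)
  have nxt: "B_next r13 r23 \<delta>1 \<delta>2 (s, top s) = (if solutions s = {} then None
      else let s' = LEAST s'. s' \<in> solutions s in Some (s', top s'))" for s
  proof -
    have "B_solutions r13 r23 \<delta>1 \<delta>2 (s, top s) = {} \<longleftrightarrow> solutions s = {}"
      using least_solution_eq(2)[of s] unfolding sol by auto
    moreover have "(LEAST \<gamma>. \<exists>\<sigma>. (\<gamma>, \<sigma>) \<in> B_solutions r13 r23 \<delta>1 \<delta>2 (s, top s)) = (LEAST s'. s' \<in> solutions s)"
      using least_solution_eq(1)[of s] unfolding sol by simp
    ultimately show ?thesis by (simp add: B_next_def phi Let_def)
  qed
  have seq: "B_seq r13 r23 \<delta>1 \<delta>2 i = map_option (\<lambda>s. (s, top s)) (walk i)" for i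
  proof (induction i)
    case (Suc i)
    then show ?case by (cases "walk i") (simp_all add: nxt Let_def)
  qed (simp add: top_0)
  define u where "u = (GREATEST i. B_seq r13 r23 \<delta>1 \<delta>2 i \<noteq> None)"
  obtain N where N: "\<And>i. walk i \<noteq> None \<Longrightarrow> i \<le> N" using walk_stops by blast
  have "(\<exists>i\<le>u. walk i = Some s) \<longleftrightarrow> step s" for s
  proof
    assume "step s"
    then obtain i where i: "walk i = Some s" using step_in_walk by blast
    have "i \<le> u" unfolding u_def
      by (rule Greatest_le_nat[of _ _ N]) (use i N in \<open>auto simp: seq\<close>)
    with i show "\<exists>i\<le>u. walk i = Some s" by blast
  qed (use walk_step in blast)
  then have "{p. \<exists>i\<le>u. B_seq r13 r23 \<delta>1 \<delta>2 i = Some p} = (\<lambda>s. (s, top s)) ` {s. step s}"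
    unfolding seq by (auto simp: image_iff)
  then show ?thesis unfolding B_set_def Let_def u_def .
qed

section \<open>The lattice of relations\<close>

lemma least_mult_le:
  assumes "n \<noteq> m" "0 < c" "c * l = i * n + j * m"
  shows "least_mult l {n, m} \<le> c"
proof -
  have "(\<Sum>a\<in>{n, m}. (if a = n then i else j) * a) = c * l" using assms by simp
  then have "c * l \<in> nat_semigroup {n, m}"
    unfolding nat_semigroup_def by (intro CollectI exI[of _ "\<lambda>a. if a = n then i else j"] exI[of _ "{n, m}"]) simp
  then show ?thesis unfolding least_mult_def using assms(2) by (intro Least_le) simp
qed

text \<open>Were \<open>s \<ge> C1\<close>, substituting the first relation into the second would express a smaller multiple of
  \<open>m2\<close> by the other two numbers.\<close>
lemma relation_coeff_less:
  fixes m1 m2 m3 C1 C2 u v s w :: nat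
  assumes "C1 * m1 = u * m2 + v * m3" "C2 * m2 = s * m1 + w * m3"
    and "0 < u" "0 < w" "0 < m2" "0 < m3"
    and min: "\<And>y i j. 0 < y \<Longrightarrow> y * m2 = i * m1 + j * m3 \<Longrightarrow> C2 \<le> y"
  shows "s < C1"
proof (rule ccontr)
  assume "\<not> s < C1"
  then obtain x where x: "s = C1 + x" by (metis le_iff_add not_less)
  have eq: "C2 * m2 = u * m2 + (x * m1 + (v + w) * m3)"
    using assms(1,2) by (simp add: x algebra_simps)
  moreover have "0 < (v + w) * m3" using assms by simp
  ultimately have "u * m2 < C2 * m2" by linarith
  then have "u < C2" by simp
  then obtain y where y: "C2 = u + y" "0 < y" by (metis less_imp_add_positive)
  with eq have "y * m2 = x * m1 + (v + w) * m3" by (simp add: algebra_simps)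
  from min[OF y(2) this] y \<open>0 < u\<close> show False by simp
qed

text \<open>Subtracting a relation whose positive part lies below \<open>u1\<close> cancels against a negative coordinate, so the
  weighted norm decreases; this drives the descent in the lattice of relations.\<close>
lemma weighted_norm_drop:
  fixes u1 u2 u3 C s t m1 m2 m3 :: int
  assumes "C * m1 = s * m2 + t * m3" "0 < m1" "0 < m2" "0 < m3" "0 < s" "0 < t"
    and "C \<le> u1" "0 \<le> C" "u2 \<le> 0" "u3 \<le> 0" "u2 < 0 \<or> u3 < 0"
  shows "\<bar>u1 - C\<bar> * m1 + \<bar>u2 + s\<bar> * m2 + \<bar>u3 + t\<bar> * m3 < \<bar>u1\<bar> * m1 + \<bar>u2\<bar> * m2 + \<bar>u3\<bar> * m3"
proof -
  have 1: "\<bar>u1 - C\<bar> * m1 = \<bar>u1\<bar> * m1 - C * m1"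
    using assms by (simp add: algebra_simps)
  have 2: "\<bar>u2 + s\<bar> * m2 \<le> (\<bar>u2\<bar> + s) * m2" and 3: "\<bar>u3 + t\<bar> * m3 \<le> (\<bar>u3\<bar> + t) * m3"
    using assms by (auto intro!: mult_right_mono)
  have "\<bar>u2 + s\<bar> * m2 < (\<bar>u2\<bar> + s) * m2 \<or> \<bar>u3 + t\<bar> * m3 < (\<bar>u3\<bar> + t) * m3"
    using assms by auto
  with 1 2 3 assms(1) show ?thesis by (auto simp: distrib_right)
qed

locale herzog_relations =
  fixes n1 n2 n3 c1 c2 c3 r12 r13 r21 r23 r31 r32 :: nat
  assumes n_pos: "0 < n1" and n12: "n1 < n2" and n23: "n2 < n3"
    and rel1: "c1 * n1 = r12 * n2 + r13 * n3"
    and rel2: "c2 * n2 = r21 * n1 + r23 * n3"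
    and rel3: "c3 * n3 = r31 * n1 + r32 * n2"
    and r_pos: "0 < r12" "0 < r13" "0 < r21" "0 < r23" "0 < r31" "0 < r32"
    and min1: "\<And>y i j. 0 < y \<Longrightarrow> y * n1 = i * n2 + j * n3 \<Longrightarrow> c1 \<le> y"
    and min2: "\<And>y i j. 0 < y \<Longrightarrow> y * n2 = i * n1 + j * n3 \<Longrightarrow> c2 \<le> y"
    and min3: "\<And>y i j. 0 < y \<Longrightarrow> y * n3 = i * n1 + j * n2 \<Longrightarrow> c3 \<le> y"
begin

lemma n_pos': "0 < n2" "0 < n3" using n_pos n12 n23 by auto

lemma coeff_less: "r21 < c1" "r31 < c1" "r12 < c2" "r32 < c2" "r13 < c3" "r23 < c3"
proof -
  show "r21 < c1"
    using relation_coeff_less[of c1 n1 r12 n2 r13 n3 c2 r21 r23] rel1 rel2 min2 r_pos n_pos n_pos'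
    by metis
  show "r31 < c1"
    using relation_coeff_less[of c1 n1 r13 n3 r12 n2 c3 r31 r32] rel1 rel3 min3 r_pos n_pos n_pos'
    by (metis add.commute)
  show "r12 < c2"
    using relation_coeff_less[of c2 n2 r21 n1 r23 n3 c1 r12 r13] rel1 rel2 min1 r_pos n_pos n_pos'
    by metis
  show "r32 < c2"
    using relation_coeff_less[of c2 n2 r23 n3 r21 n1 c3 r32 r31] rel2 rel3 min3 r_pos n_pos n_pos'
    by (metis add.commute)
  show "r13 < c3"
    using relation_coeff_less[of c3 n3 r31 n1 r32 n2 c1 r13 r12] rel1 rel3 min1 r_pos n_pos n_pos'
    by (metis add.commute)
  show "r23 < c3"
    using relation_coeff_less[of c3 n3 r32 n2 r31 n1 c2 r23 r21] rel2 rel3 min2 r_pos n_pos n_pos'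
    by (metis add.commute)
qed

text \<open>The sum of two of the three relations expresses a multiple of the third number by the other two, so
  minimality gives \<open>c3 \<le> r13 + r23\<close>, and likewise for the other two. Adding all three relations
  shows that equality holds everywhere.\<close>
lemma coeff_sums: "c1 = r21 + r31" "c2 = r12 + r32" "c3 = r13 + r23"
proof -
  obtain a1 a2 a3 b1 b2 b3 where e: "c1 = r21 + a1" "c1 = r31 + b1" "c2 = r12 + a2" "c2 = r32 + b2"
    "c3 = r13 + a3" "c3 = r23 + b3"
    using coeff_less by (metis less_imp_le_nat le_iff_add)
  have "(r13 + r23) * n3 = a1 * n1 + a2 * n2"
    using rel1 rel2 e(1,3) by (simp add: algebra_simps)
  then have 3: "c3 \<le> r13 + r23" using min3 r_pos by simp
  have "(r12 + r32) * n2 = b1 * n1 + a3 * n3"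
    using rel1 rel3 e(2,5) by (simp add: algebra_simps)
  then have 2: "c2 \<le> r12 + r32" using min2 r_pos by simp
  have "(r21 + r31) * n1 = b2 * n2 + b3 * n3"
    using rel2 rel3 e(4,6) by (simp add: algebra_simps)
  then have 1: "c1 \<le> r21 + r31" using min1 r_pos by simp
  obtain x1 x2 x3 where x: "r21 + r31 = c1 + x1" "r12 + r32 = c2 + x2" "r13 + r23 = c3 + x3"
    using 1 2 3 by (metis le_iff_add)
  have "(r21 + r31) * n1 + (r12 + r32) * n2 + (r13 + r23) * n3 = c1 * n1 + c2 * n2 + c3 * n3"
    using rel1 rel2 rel3 by (simp add: algebra_simps)
  then have "x1 * n1 + x2 * n2 + x3 * n3 = 0" unfolding x by (simp add: algebra_simps)
  then show "c1 = r21 + r31" "c2 = r12 + r32" "c3 = r13 + r23"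
    using x n_pos n_pos' by auto
qed

lemma least_int:
  fixes u1 u2 u3 :: int
  assumes "u1 * n1 + u2 * n2 + u3 * n3 = 0"
  shows "0 < u1 \<Longrightarrow> u2 \<le> 0 \<Longrightarrow> u3 \<le> 0 \<Longrightarrow> int c1 \<le> u1"
    and "u1 \<le> 0 \<Longrightarrow> 0 < u2 \<Longrightarrow> u3 \<le> 0 \<Longrightarrow> int c2 \<le> u2"
    and "u1 \<le> 0 \<Longrightarrow> u2 \<le> 0 \<Longrightarrow> 0 < u3 \<Longrightarrow> int c3 \<le> u3"
proof -
  assume a: "0 < u1" "u2 \<le> 0" "u3 \<le> 0"
  then have "int (nat u1 * n1) = int (nat (-u2) * n2 + nat (-u3) * n3)"
    using assms by simp
  then have "nat u1 * n1 = nat (-u2) * n2 + nat (-u3) * n3" by (simp only: of_nat_eq_iff)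
  from min1[OF _ this] a show "int c1 \<le> u1" by linarith
next
  assume a: "u1 \<le> 0" "0 < u2" "u3 \<le> 0"
  then have "int (nat u2 * n2) = int (nat (-u1) * n1 + nat (-u3) * n3)"
    using assms by simp
  then have "nat u2 * n2 = nat (-u1) * n1 + nat (-u3) * n3" by (simp only: of_nat_eq_iff)
  from min2[OF _ this] a show "int c2 \<le> u2" by linarith
next
  assume a: "u1 \<le> 0" "u2 \<le> 0" "0 < u3"
  then have "int (nat u3 * n3) = int (nat (-u1) * n1 + nat (-u2) * n2)"
    using assms by simp
  then have "nat u3 * n3 = nat (-u1) * n1 + nat (-u2) * n2" by (simp only: of_nat_eq_iff)
  from min3[OF _ this] a show "int c3 \<le> u3" by linarith
qed

definition in_lattice :: "int \<Rightarrow> int \<Rightarrow> int \<Rightarrow> bool" where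
  "in_lattice u1 u2 u3 \<longleftrightarrow> (\<exists>l m. u1 = l * int c1 - m * int r21 \<and>
     u2 = m * int c2 - l * int r12 \<and> u3 = - l * int r13 - m * int r23)"

lemma in_lattice_add:
  assumes "in_lattice u1 u2 u3" "in_lattice v1 v2 v3"
  shows "in_lattice (u1 + v1) (u2 + v2) (u3 + v3)"
proof -
  from assms obtain l m l' m' where
    "u1 = l * int c1 - m * int r21" "u2 = m * int c2 - l * int r12" "u3 = - l * int r13 - m * int r23"
    "v1 = l' * int c1 - m' * int r21" "v2 = m' * int c2 - l' * int r12" "v3 = - l' * int r13 - m' * int r23"
    unfolding in_lattice_def by blast
  then show ?thesis unfolding in_lattice_def
    by (intro exI[of _ "l + l'"] exI[of _ "m + m'"]) (simp add: algebra_simps)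
qed

lemma in_lattice_uminus: "in_lattice u1 u2 u3 \<Longrightarrow> in_lattice (- u1) (- u2) (- u3)"
  unfolding in_lattice_def
  by (elim exE, rule_tac x = "- l" in exI, rule_tac x = "- m" in exI) simp

lemma in_lattice_generators:
  "in_lattice (int c1) (- int r12) (- int r13)" "in_lattice (- int r21) (int c2) (- int r23)"
  "in_lattice (- int r31) (- int r32) (int c3)"
proof -
  show "in_lattice (int c1) (- int r12) (- int r13)"
    unfolding in_lattice_def by (intro exI[of _ 1] exI[of _ 0]) simp
  show "in_lattice (- int r21) (int c2) (- int r23)"
    unfolding in_lattice_def by (intro exI[of _ 0] exI[of _ 1]) simp
  show "in_lattice (- int r31) (- int r32) (int c3)"
    unfolding in_lattice_def by (intro exI[of _ "-1"] exI[of _ "-1"]) (simp add: coeff_sums)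
qed

lemma in_lattice_kernel:
  assumes "in_lattice u1 u2 u3" shows "u1 * n1 + u2 * n2 + u3 * n3 = 0"
proof -
  have "int c1 * n1 = int r12 * n2 + int r13 * n3" "int c2 * n2 = int r21 * n1 + int r23 * n3"
    using rel1 rel2 by (simp_all flip: of_nat_mult of_nat_add)
  moreover from assms obtain l m where u: "u1 = l * int c1 - m * int r21" "u2 = m * int c2 - l * int r12"
      "u3 = - l * int r13 - m * int r23"
    by (auto simp: in_lattice_def)
  moreover have "u1 * n1 + u2 * n2 + u3 * n3 = l * (int c1 * n1 - int r12 * n2 - int r13 * n3)
      + m * (int c2 * n2 - int r21 * n1 - int r23 * n3)"
    unfolding u by (simp add: algebra_simps)
  ultimately show ?thesis by simp
qed

text \<open>Up to sign a nonzero relation has exactly one positive coordinate. By minimality that coordinate is at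
  least the corresponding \<open>c\<close>, so one of the three basic relations can be subtracted.\<close>
lemma kernel_in_lattice:
  fixes u1 u2 u3 :: int
  assumes "u1 * n1 + u2 * n2 + u3 * n3 = 0"
  shows "in_lattice u1 u2 u3"
  using assms
proof (induction "nat (\<bar>u1\<bar> * n1 + \<bar>u2\<bar> * n2 + \<bar>u3\<bar> * n3)" arbitrary: u1 u2 u3 rule: less_induct)
  case less
  have n: "0 < int n1" "0 < int n2" "0 < int n3" using n_pos n_pos' by auto
  have r: "0 < int r12" "0 < int r13" "0 < int r21" "0 < int r23" "0 < int r31" "0 < int r32"
    using r_pos by auto
  have rel: "int c1 * n1 = int r12 * n2 + int r13 * n3" "int c2 * n2 = int r21 * n1 + int r23 * n3"
    "int c3 * n3 = int r31 * n1 + int r32 * n2"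
    using rel1 rel2 rel3 by (simp_all flip: of_nat_mult of_nat_add)
  have IH: "in_lattice v1 v2 v3"
    if "v1 * n1 + v2 * n2 + v3 * n3 = 0"
      "\<bar>v1\<bar> * n1 + \<bar>v2\<bar> * n2 + \<bar>v3\<bar> * n3 < \<bar>u1\<bar> * n1 + \<bar>u2\<bar> * n2 + \<bar>u3\<bar> * n3" for v1 v2 v3 :: int
  proof (rule less.hyps[OF _ that(1)])
    have "0 \<le> \<bar>v1\<bar> * n1 + \<bar>v2\<bar> * n2 + \<bar>v3\<bar> * n3" by simp
    with that(2) show "nat (\<bar>v1\<bar> * n1 + \<bar>v2\<bar> * n2 + \<bar>v3\<bar> * n3) < nat (\<bar>u1\<bar> * n1 + \<bar>u2\<bar> * n2 + \<bar>u3\<bar> * n3)"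
      by linarith
  qed
  have reduce: "in_lattice w1 w2 w3"
    if k: "w1 * n1 + w2 * n2 + w3 * n3 = 0"
      and norm: "\<bar>w1\<bar> * n1 + \<bar>w2\<bar> * n2 + \<bar>w3\<bar> * n3 = \<bar>u1\<bar> * n1 + \<bar>u2\<bar> * n2 + \<bar>u3\<bar> * n3"
      and sgn: "0 < w1 \<and> w2 \<le> 0 \<and> w3 \<le> 0 \<or> w1 \<le> 0 \<and> 0 < w2 \<and> w3 \<le> 0 \<or> w1 \<le> 0 \<and> w2 \<le> 0 \<and> 0 < w3"
    for w1 w2 w3 :: int
    using sgn
  proof (elim disjE conjE)
    assume w: "0 < w1" "w2 \<le> 0" "w3 \<le> 0"
    have "w2 < 0 \<or> w3 < 0"
    proof (rule ccontr)
      assume "\<not> (w2 < 0 \<or> w3 < 0)"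
      with w k n show False by simp
    qed
    note drop = weighted_norm_drop[OF rel(1) n(1,2,3) r(1,2) least_int(1)[OF k w] _ w(2,3) this]
    have "in_lattice (w1 - int c1) (w2 + int r12) (w3 + int r13)"
      by (rule IH) (use k rel drop norm in \<open>simp_all add: algebra_simps\<close>)
    from in_lattice_add[OF this in_lattice_generators(1)] show ?thesis by simp
  next
    assume w: "w1 \<le> 0" "0 < w2" "w3 \<le> 0"
    have "w1 < 0 \<or> w3 < 0"
    proof (rule ccontr)
      assume "\<not> (w1 < 0 \<or> w3 < 0)"
      with w k n show False by simp
    qed
    note drop = weighted_norm_drop[OF rel(2) n(2,1,3) r(3,4) least_int(2)[OF k w] _ w(1,3) this]
    have "in_lattice (w1 + int r21) (w2 - int c2) (w3 + int r23)"
      by (rule IH) (use k rel drop norm in \<open>simp_all add: algebra_simps\<close>)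
    from in_lattice_add[OF this in_lattice_generators(2)] show ?thesis by simp
  next
    assume w: "w1 \<le> 0" "w2 \<le> 0" "0 < w3"
    have "w1 < 0 \<or> w2 < 0"
    proof (rule ccontr)
      assume "\<not> (w1 < 0 \<or> w2 < 0)"
      with w k n show False by simp
    qed
    note drop = weighted_norm_drop[OF rel(3) n(3,1,2) r(5,6) least_int(3)[OF k w] _ w(1,2) this]
    have "in_lattice (w1 + int r31) (w2 + int r32) (w3 - int c3)"
      by (rule IH) (use k rel drop norm in \<open>simp_all add: algebra_simps\<close>)
    from in_lattice_add[OF this in_lattice_generators(3)] show ?thesis by simp
  qed
  have sgn: "v1 = 0 \<and> v2 = 0 \<and> v3 = 0"
    if "0 \<le> v1" "0 \<le> v2" "0 \<le> v3" "v1 * n1 + v2 * n2 + v3 * n3 = 0" for v1 v2 v3 :: int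
  proof -
    have "0 \<le> v1 * n1" "0 \<le> v2 * n2" "0 \<le> v3 * n3" using that by auto
    with that(4) have "v1 * n1 = 0" "v2 * n2 = 0" "v3 * n3 = 0" by linarith+
    with n show ?thesis by simp
  qed
  consider "u1 = 0 \<and> u2 = 0 \<and> u3 = 0"
    | "0 < u1 \<and> u2 \<le> 0 \<and> u3 \<le> 0 \<or> u1 \<le> 0 \<and> 0 < u2 \<and> u3 \<le> 0 \<or> u1 \<le> 0 \<and> u2 \<le> 0 \<and> 0 < u3"
    | "0 < - u1 \<and> - u2 \<le> 0 \<and> - u3 \<le> 0 \<or> - u1 \<le> 0 \<and> 0 < - u2 \<and> - u3 \<le> 0 \<or> - u1 \<le> 0 \<and> - u2 \<le> 0 \<and> 0 < - u3"
  proof -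
    have "\<not> (0 \<le> u1 \<and> 0 \<le> u2 \<and> 0 \<le> u3)" "\<not> (u1 \<le> 0 \<and> u2 \<le> 0 \<and> u3 \<le> 0)"
      if "\<not> (u1 = 0 \<and> u2 = 0 \<and> u3 = 0)"
      using sgn[of u1 u2 u3] sgn[of "-u1" "-u2" "-u3"] less.prems that by auto
    then show ?thesis using that by (smt (verit))
  qed
  then show ?case
  proof cases
    case 1
    then show ?thesis unfolding in_lattice_def by (intro exI[of _ 0]) simp
  next
    case 2
    then show ?thesis using reduce less.prems by blast
  next
    case 3
    then have "in_lattice (- u1) (- u2) (- u3)"
      using reduce[of "-u1" "-u2" "-u3"] less.prems by simp
    from in_lattice_uminus[OF this] show ?thesis by simp
  qed
qed

end

section \<open>Exponents of the generators\<close>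

text \<open>The relation \<open>\<alpha>h v1 - \<beta>h v2 = (hx, -hy, hz)\<close> has coordinate sum zero; here \<open>hx, hy, hz\<close> are
  \<open>(b - a)/d, b/d, a/d\<close>. It forces \<open>\<delta>2 / \<delta>1 = \<alpha>h / \<beta>h\<close>.\<close>
locale homogeneous_relation = herzog_relations +
  fixes \<alpha>h \<beta>h hx hy hz d :: nat and \<delta>1 \<delta>2 :: int
  assumes \<delta>1: "\<delta>1 = int c1 - int r12 - int r13"
    and \<delta>2: "\<delta>2 = int c2 - int r21 - int r23" "0 < \<delta>2"
    and h_pos: "0 < \<alpha>h" "0 < \<beta>h"
    and hx: "\<alpha>h * c1 + \<beta>h * r21 = hx"
    and hy: "\<alpha>h * r12 + \<beta>h * c2 = hy"
    and hz: "\<beta>h * r23 = \<alpha>h * r13 + hz" "0 < hz"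
    and hsum: "hx + hz = hy" and hcop: "coprime hy hz"
    and n_diff: "n2 = n1 + d * hz" "n3 = n1 + d * hy" "0 < d"
begin

lemma \<delta>1_pos: "0 < \<delta>1"
proof -
  have "(r12 + r13) * n1 < r12 * n2 + r13 * n3"
    using r_pos n12 n23 n_pos by (simp add: distrib_right add_strict_mono)
  then have "(r12 + r13) * n1 < c1 * n1" by (simp add: rel1)
  then have "r12 + r13 < c1" by simp
  then show ?thesis by (simp add: \<delta>1)
qed

lemma h_slope: "int \<alpha>h * \<delta>1 = int \<beta>h * \<delta>2"
proof -
  have "int hx + int hz = int hy" using hsum by simp
  then have "int \<alpha>h * int c1 + int \<beta>h * int r21 + (int \<beta>h * int r23 - int \<alpha>h * int r13) =
      int \<alpha>h * int r12 + int \<beta>h * int c2"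
    using hz(1) by (simp flip: hx hy of_nat_mult)
  then show ?thesis by (simp add: \<delta>1 \<delta>2 algebra_simps)
qed

text \<open>The fraction \<open>\<alpha>h / \<beta>h = \<delta>2 / \<delta>1\<close> is less than \<open>r23 / r13\<close> since the last coordinate
  \<open>hz\<close> of the homogeneous relation is positive.\<close>
lemma slope: "\<delta>2 * int r13 < \<delta>1 * int r23"
proof -
  have "int \<alpha>h * int r13 < int \<beta>h * int r23"
    using hz by (simp flip: of_nat_mult)
  then have "(int \<alpha>h * int r13) * \<delta>1 < (int \<beta>h * int r23) * \<delta>1"
    using \<delta>1_pos by (rule mult_strict_right_mono)
  moreover have "(int \<alpha>h * int r13) * \<delta>1 = int \<beta>h * (\<delta>2 * int r13)"
    using arg_cong[OF h_slope, of "\<lambda>x. x * int r13"] by (simp add: mult_ac)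
  moreover have "(int \<beta>h * int r23) * \<delta>1 = int \<beta>h * (\<delta>1 * int r23)"
    by (simp add: mult_ac)
  ultimately have "int \<beta>h * (\<delta>2 * int r13) < int \<beta>h * (\<delta>1 * int r23)" by simp
  then show ?thesis using h_pos by simp
qed

end

text \<open>Here \<open>\<epsilon>\<close> and \<open>\<eta>\<close> are characterized without fractions: \<open>\<delta>2 n < e \<delta>1\<close> and \<open>e r13 \<le> n r23\<close> say
  that \<open>e / n\<close> lies in the interval from \<open>\<delta>2 / \<delta>1\<close>, excluded, to \<open>r23 / r13\<close>, included.\<close>
locale tangent_cone = homogeneous_relation +
  fixes \<epsilon> \<eta> :: nat
  assumes \<epsilon>\<eta>: "0 < \<epsilon>" "\<delta>2 * int \<epsilon> < int \<eta> * \<delta>1" "\<eta> * r13 \<le> \<epsilon> * r23"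
    and \<epsilon>_min: "\<And>n e. 0 < n \<Longrightarrow> \<delta>2 * int n < int e * \<delta>1 \<Longrightarrow> e * r13 \<le> n * r23 \<Longrightarrow> \<epsilon> \<le> n"
    and \<eta>_min: "\<And>e. \<delta>2 * int \<epsilon> < int e * \<delta>1 \<Longrightarrow> \<eta> \<le> e"
begin

sublocale A: staircase "int r13" "int r23" "int r13" "int r23"
  using r_pos by unfold_locales auto

sublocale B: staircase \<delta>2 \<delta>1 "int r23" "int r13"
  using r_pos \<delta>1_pos \<delta>2 slope by unfold_locales (auto simp: mult.commute)

lemma A_adm_slope:
  assumes "A.adm \<beta> \<alpha>" shows "int \<beta> * \<delta>2 < int \<alpha> * \<delta>1"
proof -
  have "int \<beta> * (\<delta>2 * int r13) \<le> int \<beta> * (\<delta>1 * int r23)"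
    using slope by (intro mult_left_mono) auto
  moreover have "int \<beta> * int r23 * \<delta>1 < int \<alpha> * int r13 * \<delta>1"
    using assms \<delta>1_pos unfolding A.adm_def by (intro mult_strict_right_mono)
  ultimately have "int r13 * (int \<beta> * \<delta>2) < int r13 * (int \<alpha> * \<delta>1)"
    by (simp add: algebra_simps)
  then show ?thesis using r_pos by simp
qed

lemma A_adm_nat: "A.adm \<beta> \<alpha> \<longleftrightarrow> \<beta> * r23 < \<alpha> * r13"
  unfolding A.adm_def by (simp flip: of_nat_mult)

lemma B_adm_nat: "B.adm \<gamma> \<sigma> \<Longrightarrow> \<gamma> * r13 < \<sigma> * r23"
  using B.val_pos[of \<gamma> \<sigma>] unfolding B.val_def by (simp flip: of_nat_mult)

text \<open>Subtracting \<open>n1\<close> times the degree from the weight leaves \<open>d (hz u2 + hy u3) = 0\<close>, whose solutions are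
  the multiples of \<open>(hy, -hz)\<close> because \<open>hy\<close> and \<open>hz\<close> are coprime.\<close>
lemma fibre_coordinates:
  fixes u1 u2 u3 :: int
  assumes "u1 * n1 + u2 * n2 + u3 * n3 = 0" "u1 + u2 + u3 = 0"
  shows "\<exists>s. u1 = - s * int hx \<and> u2 = s * int hy \<and> u3 = - s * int hz"
proof -
  have "int d * (u2 * hz + u3 * hy) = (u1 * n1 + u2 * n2 + u3 * n3) - (u1 + u2 + u3) * n1"
    by (simp add: n_diff(1,2) algebra_simps)
  then have eq: "u2 * hz + u3 * hy = 0" using assms n_diff(3) by simp
  then have "u2 * int hz = int hy * (- u3)" by (simp add: algebra_simps)
  then have "int hy dvd u2 * int hz" by (rule dvdI)
  then have "int hy dvd u2" using hcop by (simp add: coprime_dvd_mult_left_iff)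
  then obtain s where s: "u2 = s * int hy" by (metis dvdE mult.commute)
  have "int hy * (s * int hz + u3) = 0" using eq by (simp add: s algebra_simps)
  moreover have "hy \<noteq> 0" using hz hsum by simp
  ultimately have u3: "u3 = - s * int hz" by simp
  have "u1 = - s * int hy + s * int hz" using assms(2) s u3 by simp
  also have "\<dots> = - s * int hx" by (simp add: algebra_simps flip: hsum)
  finally show ?thesis using s u3 by blast
qed

lemma h_weight: "n1 * hx + n3 * hz = n2 * hy"
  by (simp add: n_diff algebra_simps flip: hsum)

sublocale binomial_fibres n1 n2 n3 hx hy hz
proof
  show "0 < hy" "0 < hz" "hx + hz = hy" "n1 * hx + n3 * hz = n2 * hy"
    using hz hsum h_weight by auto
next
  fix m m' assume m: "wt n1 n2 n3 m = wt n1 n2 n3 m'" "mdeg m = mdeg m'"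
    "Poly_Mapping.lookup m' Y \<le> Poly_Mapping.lookup m Y"
  let ?l = "\<lambda>m v. int (Poly_Mapping.lookup m v)"
  have "int (wt n1 n2 n3 m) = int (wt n1 n2 n3 m')" "int (mdeg m) = int (mdeg m')" using m by simp_all
  then have "(?l m X - ?l m' X) * n1 + (?l m Y - ?l m' Y) * n2 + (?l m Z - ?l m' Z) * n3 = 0"
    "(?l m X - ?l m' X) + (?l m Y - ?l m' Y) + (?l m Z - ?l m' Z) = 0"
    by (simp_all add: wt_def mdeg_eq algebra_simps)
  from fibre_coordinates[OF this] obtain s where s: "?l m X - ?l m' X = - s * int hx"
    "?l m Y - ?l m' Y = s * int hy" "?l m Z - ?l m' Z = - s * int hz" by blast
  have "0 \<le> s * int hy" using s(2) m(3) by linarith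
  then have "0 \<le> s" using hz hsum by (simp add: zero_le_mult_iff)
  then obtain k where k: "s = int k" by (metis zero_le_imp_eq_int)
  have "int (Poly_Mapping.lookup m' X) = int (Poly_Mapping.lookup m X + k * hx)"
    "int (Poly_Mapping.lookup m Y) = int (Poly_Mapping.lookup m' Y + k * hy)"
    "int (Poly_Mapping.lookup m' Z) = int (Poly_Mapping.lookup m Z + k * hz)"
    using s by (simp_all add: k)
  then have "m = xyz (Poly_Mapping.lookup m X) (Poly_Mapping.lookup m' Y) (Poly_Mapping.lookup m Z) + xyz 0 (k * hy) 0"
    "m' = xyz (Poly_Mapping.lookup m X) (Poly_Mapping.lookup m' Y) (Poly_Mapping.lookup m Z) + xyz (k * hx) 0 (k * hz)"
    by (simp_all add: mon_eq_iff xyz_add flip: of_nat_mult of_nat_add)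
  then show "\<exists>t s. m = t + xyz 0 (s * hy) 0 \<and> m' = t + xyz (s * hx) 0 (s * hz)" by blast
qed

lemma improvable_iff:
  "xyz i j k \<in> improvable n1 n2 n3 \<longleftrightarrow> (\<exists>(l :: int) (m :: int). 0 < l * \<delta>1 + m * \<delta>2 \<and>
     m * int r21 \<le> int i + l * int c1 \<and> l * int r12 \<le> int j + m * int c2 \<and>
     l * int r13 + m * int r23 \<le> int k)"
proof
  assume "xyz i j k \<in> improvable n1 n2 n3"
  then obtain m' where m': "wt n1 n2 n3 m' = wt n1 n2 n3 (xyz i j k)" "mdeg (xyz i j k) < mdeg m'"
    by (auto simp: improvable_def)
  define x y z where xyz: "x = Poly_Mapping.lookup m' X" "y = Poly_Mapping.lookup m' Y" "z = Poly_Mapping.lookup m' Z"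
  have "int (n1 * x + n2 * y + n3 * z) = int (n1 * i + n2 * j + n3 * k)"
    using m'(1) by (simp add: wt_def xyz)
  then have "(int x - int i) * n1 + (int y - int j) * n2 + (int z - int k) * n3 = 0"
    by (simp add: algebra_simps)
  from kernel_in_lattice[OF this] obtain l m where lm: "int x - int i = l * int c1 - m * int r21"
    "int y - int j = m * int c2 - l * int r12" "int z - int k = - l * int r13 - m * int r23"
    by (auto simp: in_lattice_def)
  have "int (i + j + k) < int (x + y + z)"
    using m'(2) by (simp add: mdeg_eq xyz)
  then have "0 < (int x - int i) + (int y - int j) + (int z - int k)" by simp
  then have "0 < l * \<delta>1 + m * \<delta>2"
    unfolding lm \<delta>1 \<delta>2(1) by (simp add: algebra_simps)
  with lm show "\<exists>(l :: int) (m :: int). 0 < l * \<delta>1 + m * \<delta>2 \<and>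
     m * int r21 \<le> int i + l * int c1 \<and> l * int r12 \<le> int j + m * int c2 \<and>
     l * int r13 + m * int r23 \<le> int k"
    by (intro exI[of _ l] exI[of _ m]) auto
next
  assume "\<exists>(l :: int) (m :: int). 0 < l * \<delta>1 + m * \<delta>2 \<and>
     m * int r21 \<le> int i + l * int c1 \<and> l * int r12 \<le> int j + m * int c2 \<and>
     l * int r13 + m * int r23 \<le> int k"
  then obtain l m :: int where lm: "0 < l * \<delta>1 + m * \<delta>2" "m * int r21 \<le> int i + l * int c1"
    "l * int r12 \<le> int j + m * int c2" "l * int r13 + m * int r23 \<le> int k" by blast
  define u1 u2 u3 where u: "u1 = l * int c1 - m * int r21" "u2 = m * int c2 - l * int r12"
    "u3 = - l * int r13 - m * int r23"
  define x y z where xyz: "x = nat (i + u1)" "y = nat (j + u2)" "z = nat (k + u3)"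
  have e: "int x = i + u1" "int y = j + u2" "int z = k + u3"
    unfolding xyz using lm u by simp_all
  have "u1 * n1 + u2 * n2 + u3 * n3 = 0"
    by (rule in_lattice_kernel) (auto simp: in_lattice_def u)
  then have "int (n1 * x + n2 * y + n3 * z) = int (n1 * i + n2 * j + n3 * k)"
    by (simp add: e algebra_simps)
  then have "wt n1 n2 n3 (xyz x y z) = wt n1 n2 n3 (xyz i j k)"
    unfolding wt_def lookup_xyz by (simp only: of_nat_eq_iff)
  moreover have "int (i + j + k) < int (x + y + z)"
    using lm(1) by (simp add: e u \<delta>1 \<delta>2(1) algebra_simps)
  then have "mdeg (xyz i j k) < mdeg (xyz x y z)" unfolding mdeg_eq lookup_xyz by (simp only: of_nat_less_iff)
  ultimately show "xyz i j k \<in> improvable n1 n2 n3" by (auto simp: improvable_def)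
qed

text \<open>The four cases come from the signs of \<open>\<lambda>\<close> and \<open>\<mu>\<close>, the second and third from whether the relation
  has a negative \<open>z\<close>-coordinate. They correspond to \<open>z^c3\<close>, the \<open>p\<close>, the pure powers of \<open>y\<close>, and the
  \<open>q\<close>.\<close>
lemma improvable_cases:
  assumes "xyz i j k \<in> improvable n1 n2 n3"
  obtains "c3 \<le> k"
    | \<alpha> \<beta> where "A.adm \<beta> \<alpha>" "\<alpha> * r12 + \<beta> * c2 \<le> j" "\<alpha> * r13 - \<beta> * r23 \<le> k"
    | \<alpha> \<beta> where "\<delta>2 * int \<beta> < int \<alpha> * \<delta>1" "\<alpha> * r13 \<le> \<beta> * r23" "\<alpha> * r12 + \<beta> * c2 \<le> j"
    | \<gamma> \<sigma> where "B.adm \<gamma> \<sigma>" "\<gamma> * c1 + \<sigma> * r21 \<le> i" "\<sigma> * r23 - \<gamma> * r13 \<le> k"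
proof -
  from assms obtain l m :: int where lm: "0 < l * \<delta>1 + m * \<delta>2" "m * int r21 \<le> int i + l * int c1"
    "l * int r12 \<le> int j + m * int c2" "l * int r13 + m * int r23 \<le> int k" by (auto simp: improvable_iff)
  have d: "0 < \<delta>1" "0 < \<delta>2" using \<delta>1_pos \<delta>2 by auto
  consider "0 < l" "0 < m" | "0 < l" "m \<le> 0" | "l \<le> 0" "0 < m"
  proof -
    have "\<not> (l \<le> 0 \<and> m \<le> 0)"
    proof
      assume "l \<le> 0 \<and> m \<le> 0"
      then have "l * \<delta>1 \<le> 0" "m * \<delta>2 \<le> 0" using d by (auto simp: mult_nonpos_nonneg)
      with lm(1) show False by linarith
    qed
    then show ?thesis using that by linarith
  qed
  then show ?thesis
  proof cases
    case 1
    have "1 * int r13 \<le> l * r13" "1 * int r23 \<le> m * r23" using 1 by (intro mult_right_mono; simp)+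
    then have "int c3 \<le> int k" using lm(4) coeff_sums(3) by simp
    then show ?thesis using that(1) by simp
  next
    case 2
    define \<alpha> \<beta> where ab: "\<alpha> = nat l" "\<beta> = nat (- m)"
    have e: "l = int \<alpha>" "m = - int \<beta>" using 2 by (simp_all add: ab)
    have j: "\<alpha> * r12 + \<beta> * c2 \<le> j" using lm(3) unfolding e by (simp flip: of_nat_mult of_nat_add) 
    show ?thesis
    proof (cases "A.adm \<beta> \<alpha>")
      case True
      have "int (\<alpha> * r13) \<le> int (k + \<beta> * r23)" using lm(4) unfolding e by simp
      then have "\<alpha> * r13 - \<beta> * r23 \<le> k" by linarith
      with True j that(2) show ?thesis by blast
    next
      case False
      have "\<delta>2 * int \<beta> < int \<alpha> * \<delta>1" using lm(1) unfolding e by (simp add: mult.commute)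
      with False j that(3) show ?thesis by (simp add: A_adm_nat)
    qed
  next
    case 3
    define \<gamma> \<sigma> where gs: "\<gamma> = nat (- l)" "\<sigma> = nat m"
    have e: "l = - int \<gamma>" "m = int \<sigma>" using 3 by (simp_all add: gs)
    have "B.adm \<gamma> \<sigma>" using lm(1) unfolding e B.adm_def by simp
    moreover have "int (\<gamma> * c1 + \<sigma> * r21) \<le> int i" "int (\<sigma> * r23) \<le> int (k + \<gamma> * r13)"
      using lm(2,4) unfolding e by simp_all
    then have "\<gamma> * c1 + \<sigma> * r21 \<le> i" "\<sigma> * r23 - \<gamma> * r13 \<le> k" by linarith+
    ultimately show ?thesis using that(4) by blast
  qed
qed

text \<open>The exponents of \<open>p\<close>, \<open>q\<close> and \<open>g\<close>. The subtractions are exact at admissible pairs.\<close>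
definition exA :: "nat \<Rightarrow> nat \<Rightarrow> mon" where
  "exA \<alpha> \<beta> = xyz 0 (\<alpha> * r12 + \<beta> * c2) (\<alpha> * r13 - \<beta> * r23)"

definition exB :: "nat \<Rightarrow> nat \<Rightarrow> mon" where
  "exB \<gamma> \<sigma> = xyz (\<gamma> * c1 + \<sigma> * r21) 0 (\<sigma> * r23 - \<gamma> * r13)"

definition exg :: mon where
  "exg = xyz 0 (\<eta> * r12 + \<epsilon> * c2) 0"

lemma improvable_c3: "xyz 0 0 c3 \<in> improvable n1 n2 n3"
  unfolding improvable_iff using coeff_sums \<delta>1_pos \<delta>2(2) by (intro exI[of _ 1]) auto

lemma improvableI:
  assumes "0 < l * \<delta>1 + m * \<delta>2" "m * int r21 \<le> int i + l * int c1"
    "l * int r12 \<le> int j + m * int c2" "l * int r13 + m * int r23 \<le> int k"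
  shows "xyz i j k \<in> improvable n1 n2 n3"
  unfolding improvable_iff using assms by blast

lemma neg_nat_product_le: "- (int x * int y) \<le> int v * int w"
  by (rule order_trans[of _ 0]) auto

lemma improvable_exA: "A.adm \<beta> \<alpha> \<Longrightarrow> exA \<alpha> \<beta> \<in> improvable n1 n2 n3"
  unfolding exA_def using A_adm_slope[of \<beta> \<alpha>]
  by (intro improvableI[of "int \<alpha>" "- int \<beta>"]) (simp_all add: A_adm_nat of_nat_diff neg_nat_product_le)

lemma improvable_exg: "exg \<in> improvable n1 n2 n3"
proof -
  have "int (\<eta> * r13) \<le> int (\<epsilon> * r23)" using \<epsilon>\<eta>(3) by (simp only: of_nat_le_iff)
  then show ?thesis
    unfolding exg_def using \<epsilon>\<eta>(2)
    by (intro improvableI[of "int \<eta>" "- int \<epsilon>"])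
      (simp_all add: mult.commute[of \<delta>2] neg_nat_product_le)
qed

lemma improvable_exB: "B.adm \<gamma> \<sigma> \<Longrightarrow> exB \<gamma> \<sigma> \<in> improvable n1 n2 n3"
  unfolding exB_def using B_adm_nat[of \<gamma> \<sigma>]
  by (intro improvableI[of "- int \<gamma>" "int \<sigma>"]) (simp_all add: B.adm_def of_nat_diff neg_nat_product_le)

lemma exA_in_ideal:
  fixes G :: "'k::field poly3 set"
  assumes "A.adm s t" "monomial (exA t s) \<in> ideal_gen G" "s \<le> \<beta>" "t \<le> \<alpha>" "A.val s t \<le> A.val \<beta> \<alpha>"
  shows "monomial (exA \<alpha> \<beta>) \<in> ideal_gen G"
proof -
  have "int (t * r13) - int (s * r23) \<le> int (\<alpha> * r13) - int (\<beta> * r23)"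
    using assms(5) by (simp add: A.val_def)
  then have "t * r13 - s * r23 \<le> \<alpha> * r13 - \<beta> * r23" by linarith
  with assms show ?thesis unfolding exA_def
    by (intro mono_in_ideal_gen'[OF assms(2)[unfolded exA_def]]) (auto intro!: add_mono mult_right_mono)
qed

lemma exB_in_ideal:
  fixes G :: "'k::field poly3 set"
  assumes steps: "\<And>s. B.step s \<Longrightarrow> monomial (exB s (B.top s)) \<in> ideal_gen G" and adm: "B.adm \<gamma> \<sigma>"
  shows "monomial (exB \<gamma> \<sigma>) \<in> ideal_gen G"
proof -
  obtain s where s: "B.step s" "s \<le> \<gamma>" "B.top s \<le> \<sigma>" "B.val s (B.top s) \<le> B.val \<gamma> \<sigma>"
    using B.step_below[OF adm] by metis
  have "int (B.top s * r23) - int (s * r13) \<le> int (\<sigma> * r23) - int (\<gamma> * r13)"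
    using s(4) by (simp add: B.val_def)
  then have "B.top s * r23 - s * r13 \<le> \<sigma> * r23 - \<gamma> * r13" by linarith
  with s show ?thesis unfolding exB_def
    by (intro mono_in_ideal_gen'[OF steps[OF s(1), unfolded exB_def]]) (auto intro!: add_mono mult_right_mono)
qed

text \<open>The number \<open>\<eta>\<close> is the least integer above \<open>\<epsilon> \<delta>2 / \<delta>1\<close>, so from \<open>\<beta> \<ge> \<epsilon>\<close> and
  \<open>\<alpha> > \<beta> \<delta>2 / \<delta>1\<close> both entries of \<open>(\<alpha>, \<beta>)\<close> are at least those of \<open>(\<eta>, \<epsilon>)\<close>.\<close>
lemma pure_power_in_ideal:
  fixes G :: "'k::field poly3 set"
  assumes "monomial exg \<in> ideal_gen G" "\<delta>2 * int \<beta> < int \<alpha> * \<delta>1" "\<epsilon> \<le> \<beta>"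
  shows "monomial (xyz i (\<alpha> * r12 + \<beta> * c2) k) \<in> ideal_gen G"
proof -
  have "\<delta>2 * int \<epsilon> \<le> \<delta>2 * int \<beta>" using assms(3) \<delta>2 by (intro mult_left_mono) auto
  then have "\<eta> \<le> \<alpha>" using assms(2) by (intro \<eta>_min) linarith
  then show ?thesis using assms(3)
    by (intro mono_in_ideal_gen'[OF assms(1)[unfolded exg_def]]) (auto intro!: add_mono mult_right_mono)
qed

lemma improvable_in_ideal:
  fixes G :: "'k::field poly3 set"
  assumes z: "monomial (xyz 0 0 c3) \<in> ideal_gen G" and g: "monomial exg \<in> ideal_gen G"
    and A: "\<And>\<alpha> \<beta>. A.adm \<beta> \<alpha> \<Longrightarrow> monomial (exA \<alpha> \<beta>) \<in> ideal_gen G"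
    and B: "\<And>s. B.step s \<Longrightarrow> monomial (exB s (B.top s)) \<in> ideal_gen G"
    and m: "m \<in> improvable n1 n2 n3"
  shows "monomial m \<in> ideal_gen G"
proof -
  define i j k where ijk: "i = Poly_Mapping.lookup m X" "j = Poly_Mapping.lookup m Y" "k = Poly_Mapping.lookup m Z"
  have m_eq: "m = xyz i j k" by (simp add: mon_eq_iff ijk)
  from m[unfolded m_eq] show ?thesis unfolding m_eq
  proof (cases rule: improvable_cases)
    case 1
    then show "monomial (xyz i j k) \<in> ideal_gen G" by (intro mono_in_ideal_gen'[OF z]) auto
  next
    case (2 \<alpha> \<beta>)
    then show "monomial (xyz i j k) \<in> ideal_gen G"
      by (intro mono_in_ideal_gen'[OF A[OF 2(1), unfolded exA_def]]) auto
  next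
    case (3 \<alpha> \<beta>)
    have "\<beta> \<noteq> 0"
    proof
      assume "\<beta> = 0"
      then show False using 3(1,2) r_pos by simp
    qed
    then have "\<epsilon> \<le> \<beta>" using 3 by (intro \<epsilon>_min) auto
    from pure_power_in_ideal[OF g 3(1) this, of 0 0] 3(3)
    show "monomial (xyz i j k) \<in> ideal_gen G" by (auto intro: mono_in_ideal_gen')
  next
    case (4 \<gamma> \<sigma>)
    then show "monomial (xyz i j k) \<in> ideal_gen G"
      by (intro mono_in_ideal_gen'[OF exB_in_ideal[OF B 4(1), unfolded exB_def]]) auto
  qed
qed

lemma exA_steps_in_ideal:
  fixes G :: "'k::field poly3 set"
  assumes steps: "\<And>s. A.step s \<Longrightarrow> s < \<epsilon> \<Longrightarrow> monomial (exA (A.top s) s) \<in> ideal_gen G"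
    and g: "monomial exg \<in> ideal_gen G" and adm: "A.adm \<beta> \<alpha>"
  shows "monomial (exA \<alpha> \<beta>) \<in> ideal_gen G"
proof (cases "\<beta> < \<epsilon>")
  case True
  obtain s where s: "A.step s" "s \<le> \<beta>" "A.top s \<le> \<alpha>" "A.val s (A.top s) \<le> A.val \<beta> \<alpha>"
    using A.step_below[OF adm] by metis
  have "s < \<epsilon>" using True s(2) by simp
  from exA_in_ideal[OF A.adm_top steps[OF s(1) this] s(2,3,4)] show ?thesis .
next
  case False
  then show ?thesis
    using A_adm_slope[OF adm] unfolding exA_def
    by (intro pure_power_in_ideal[OF g]) (auto simp: mult.commute)
qed

section \<open>Reduction by the homogeneous binomial\<close>

lemma swap_in_ideal:
  fixes G :: "'k::field poly3 set"
  assumes "hbin \<in> ideal_gen G" "monomial (xyz (i + hx) j (k + hz)) \<in> ideal_gen G"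
  shows "monomial (xyz i (j + hy) k) \<in> ideal_gen G"
proof -
  have "monomial (xyz i j k) * hbin = monomial (xyz i (j + hy) k) - (monomial (xyz (i + hx) j (k + hz)) :: 'k poly3)"
    by (simp add: hbin_def right_diff_distrib mono_mult xyz_add)
  then have "monomial (xyz i (j + hy) k) = monomial (xyz i j k) * hbin + (monomial (xyz (i + hx) j (k + hz)) :: 'k poly3)"
    by (simp only: diff_add_cancel)
  then show ?thesis using assms by (simp add: ideal_gen_add ideal_gen_mult)
qed

text \<open>Reduction by \<open>h\<close> subtracts \<open>(\<alpha>h, \<beta>h)\<close> from a pair; as \<open>\<alpha>h / \<beta>h = \<delta>2 / \<delta>1\<close>, only the second
  entry can prevent it.\<close>
lemma above_h:
  assumes "\<beta>h \<le> \<beta>" "int \<beta> * \<delta>2 < int \<alpha> * \<delta>1" shows "\<alpha>h < \<alpha>"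
proof -
  have "int \<beta>h * \<delta>2 \<le> int \<beta> * \<delta>2" using assms \<delta>2 by (intro mult_right_mono) auto
  then have "int \<alpha>h * \<delta>1 < int \<alpha> * \<delta>1" using assms h_slope by linarith
  then show ?thesis using \<delta>1_pos by simp
qed

text \<open>Modulo \<open>h\<close>, the monomial at \<open>(\<alpha>, \<beta>)\<close> equals a multiple of the one at
  \<open>(\<alpha> - \<alpha>h, \<beta> - \<beta>h)\<close>: trading \<open>y^hy\<close> for \<open>x^hx z^hz\<close> raises the exponent of \<open>z\<close> by exactly
  \<open>hz = \<beta>h r23 - \<alpha>h r13\<close>.\<close>
lemma exA_in_ideal_h:
  fixes G :: "'k::field poly3 set"
  assumes h: "hbin \<in> ideal_gen G"
    and steps: "\<And>s. A.step s \<Longrightarrow> s < \<beta>h \<Longrightarrow> monomial (exA (A.top s) s) \<in> ideal_gen G"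
  shows "A.adm \<beta> \<alpha> \<Longrightarrow> monomial (exA \<alpha> \<beta>) \<in> ideal_gen G"
proof (induction \<beta> arbitrary: \<alpha> rule: less_induct)
  case (less \<beta>)
  show ?case
  proof (cases "\<beta> < \<beta>h")
    case True
    obtain s where s: "A.step s" "s \<le> \<beta>" "A.top s \<le> \<alpha>" "A.val s (A.top s) \<le> A.val \<beta> \<alpha>"
      using A.step_below[OF less.prems] by metis
    have "s < \<beta>h" using True s(2) by simp
    from exA_in_ideal[OF A.adm_top steps[OF s(1) this] s(2,3,4)] show ?thesis .
  next
    case False
    then have "\<alpha>h < \<alpha>" using above_h[OF _ A_adm_slope[OF less.prems]] by simp
    then obtain a' b' where ab: "\<alpha> = \<alpha>h + a'" "\<beta> = \<beta>h + b'"
      using False by (metis le_iff_add less_imp_le_nat not_less)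
    have lt: "\<beta> * r23 < \<alpha> * r13" using less.prems by (simp add: A_adm_nat)
    have z: "a' * r13 = b' * r23 + (\<alpha> * r13 - \<beta> * r23 + hz)"
      using lt hz(1) unfolding ab by (simp add: distrib_right)
    then have "A.adm b' a'" using hz by (simp add: A_adm_nat)
    then have "monomial (exA a' b') \<in> ideal_gen G" using less.IH[of b' a'] ab h_pos by simp
    then have "monomial (xyz (0 + hx) (a' * r12 + b' * c2) (\<alpha> * r13 - \<beta> * r23 + hz)) \<in> ideal_gen G"
      unfolding exA_def by (rule mono_in_ideal_gen') (simp_all add: z)
    from swap_in_ideal[OF h this] show ?thesis
      unfolding exA_def ab by (simp add: algebra_simps flip: hy)
  qed
qed

text \<open>After one reduction by \<open>h\<close> the pair \<open>(\<eta> - \<alpha>h, \<epsilon> - \<beta>h)\<close> is above the slope \<open>r23 / r13\<close>, for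
  otherwise its quotient would lie in the interval, with a denominator less than \<open>\<epsilon>\<close>.\<close>
lemma exg_in_ideal_h:
  fixes G :: "'k::field poly3 set"
  assumes h: "hbin \<in> ideal_gen G" and le: "\<beta>h \<le> \<epsilon>"
    and A: "\<And>\<alpha> \<beta>. A.adm \<beta> \<alpha> \<Longrightarrow> monomial (exA \<alpha> \<beta>) \<in> ideal_gen G"
  shows "monomial exg \<in> ideal_gen G"
proof -
  have "\<alpha>h < \<eta>" using above_h[OF le] \<epsilon>\<eta>(2) by (simp add: mult.commute)
  then obtain a' b' where ab: "\<eta> = \<alpha>h + a'" "\<epsilon> = \<beta>h + b'" "0 < a'"
    using le by (metis le_iff_add less_imp_add_positive)
  have slope': "\<delta>2 * int b' < int a' * \<delta>1"
    using \<epsilon>\<eta>(2) h_slope by (simp add: ab algebra_simps)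
  \<comment> \<open>Otherwise \<open>a' / b'\<close> contradicts the minimality of \<open>\<epsilon>\<close>.\<close>
  have "A.adm b' a'"
  proof (rule ccontr)
    assume "\<not> A.adm b' a'"
    then have le': "a' * r13 \<le> b' * r23" by (simp add: A_adm_nat)
    then have "0 < b'" using ab(3) r_pos by (metis gr0I mult_0 mult_is_0 le_zero_eq neq0_conv)
    from \<epsilon>_min[OF this slope' le'] show False using ab h_pos by simp
  qed
  moreover have "a' * r13 - b' * r23 \<le> hz"
    using \<epsilon>\<eta>(3) hz(1) unfolding ab by (simp add: distrib_right)
  ultimately have "monomial (xyz (0 + hx) (a' * r12 + b' * c2) (0 + hz)) \<in> ideal_gen G"
    using A[of b' a'] unfolding exA_def by (auto intro: mono_in_ideal_gen')
  from swap_in_ideal[OF h this] show ?thesis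
    unfolding exg_def unfolding ab by (simp add: algebra_simps flip: hy)
qed

text \<open>Here \<open>(\<alpha>h, \<beta>h)\<close> dominates \<open>(\<eta>, \<epsilon>)\<close>, so the power of \<open>y\<close> in \<open>h\<close> is a multiple of \<open>g\<close>, and the other
  term is a multiple of \<open>q\<close> at the difference of the two pairs.\<close>
lemma hbin_in_ideal:
  fixes G :: "'k::field poly3 set"
  assumes g: "monomial exg \<in> ideal_gen G" and lt: "\<epsilon> < \<beta>h"
    and B: "\<And>s. B.step s \<Longrightarrow> monomial (exB s (B.top s)) \<in> ideal_gen G"
  shows "hbin \<in> ideal_gen G"
proof -
  have "\<delta>2 * int \<epsilon> < \<delta>2 * int \<beta>h" using lt \<delta>2 by (intro mult_strict_left_mono) auto
  then have "\<eta> \<le> \<alpha>h" using h_slope by (intro \<eta>_min) (simp add: mult.commute)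
  then obtain a' b' where ab: "\<alpha>h = \<eta> + a'" "\<beta>h = \<epsilon> + b'" using lt by (metis le_iff_add less_imp_le_nat)
  have "monomial (xyz 0 hy 0) \<in> ideal_gen G"
    using g unfolding exg_def by (rule mono_in_ideal_gen') (simp_all add: ab algebra_simps flip: hy)
  moreover have "B.adm a' b'"
    using \<epsilon>\<eta>(2) h_slope unfolding B.adm_def ab by (simp add: algebra_simps)
  then have "monomial (exB a' b') \<in> ideal_gen G" by (rule exB_in_ideal[rotated]) (rule B)
  then have "monomial (xyz hx 0 hz) \<in> ideal_gen G" unfolding exB_def
  proof (rule mono_in_ideal_gen')
    show "a' * c1 + b' * r21 \<le> hx" by (simp add: ab algebra_simps flip: hx)
    show "b' * r23 - a' * r13 \<le> hz"
      using \<epsilon>\<eta>(3) hz(1) unfolding ab by (simp add: distrib_right)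
  qed simp_all
  ultimately show ?thesis unfolding hbin_def by (rule ideal_gen_diff)
qed

section \<open>Bounds on the steps\<close>

text \<open>Subtracting \<open>(\<alpha>h, \<beta>h)\<close> from a point with \<open>s \<ge> \<alpha>h\<close> keeps it admissible and lowers its value by
  \<open>hz\<close>, which is impossible for a step.\<close>
lemma B_step_bounds:
  assumes "B.step s"
  shows "s < \<alpha>h" "B.top s \<le> \<beta>h"
proof -
  let ?t = "B.top s"
  have adm: "int s * \<delta>1 < int ?t * \<delta>2" using B.adm_top[of s] by (simp add: B.adm_def)
  show *: "s < \<alpha>h"
  proof (rule ccontr)
    assume "\<not> s < \<alpha>h"
    then obtain x where x: "s = \<alpha>h + x" by (metis le_iff_add not_less)
    have "int \<beta>h * \<delta>2 \<le> int s * \<delta>1" using h_slope \<delta>1_pos by (simp add: x distrib_right)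
    then have "int \<beta>h * \<delta>2 < int ?t * \<delta>2" using adm by linarith
    then have "\<beta>h < ?t" using \<delta>2 by simp
    then obtain y where y: "?t = \<beta>h + y" by (metis le_iff_add less_imp_le_nat)
    have "B.adm x y" using adm h_slope unfolding B.adm_def y by (simp add: x distrib_right)
    then have "B.val x (B.top x) \<le> B.val x y" by (simp add: B.adm_iff B.val_mono)
    also have "\<dots> = B.val s ?t - hz"
      unfolding B.val_def y using arg_cong[OF hz(1), of int] by (simp add: x algebra_simps)
    also have "\<dots> < B.val s ?t" using hz by simp
    also have "\<dots> < B.val x (B.top x)" using B.step_less[OF assms, of x] h_pos by (simp add: x)
    finally show False .
  qed
  have "int s * \<delta>1 < int \<beta>h * \<delta>2"
    using * \<delta>1_pos by (simp flip: h_slope)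
  then show "?t \<le> \<beta>h" by (simp add: B.adm_def flip: B.adm_iff)
qed

text \<open>By \<open>fibre_coordinates\<close> a homogeneous relation \<open>y v2 - x v1\<close> is a multiple of \<open>(-hx, hy, -hz)\<close>; since the slope
  is the same, so is \<open>y\<close> of \<open>\<beta>h\<close>.\<close>
lemma h_primitive:
  assumes "int x * \<delta>1 = int y * \<delta>2" shows "\<beta>h dvd y"
proof -
  define u1 u2 u3 where u: "u1 = - int x * int c1 - int y * int r21" "u2 = int y * int c2 + int x * int r12"
    "u3 = int x * int r13 - int y * int r23"
  have "u1 * n1 + u2 * n2 + u3 * n3 = 0"
    by (rule in_lattice_kernel, unfold in_lattice_def, rule exI[of _ "- int x"], rule exI[of _ "int y"])
      (simp add: u)
  moreover have "u1 + u2 + u3 = int y * \<delta>2 - int x * \<delta>1"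
    by (simp add: u \<delta>1 \<delta>2(1) algebra_simps)
  ultimately obtain s where s: "u2 = s * int hy" using fibre_coordinates assms by fastforce
  let ?K = "\<delta>1 * int c2 + \<delta>2 * int r12"
  have "int y * ?K = \<delta>1 * u2" using assms by (simp add: u algebra_simps)
  also have "\<dots> = s * (\<delta>1 * int hy)" by (simp add: s)
  also have "\<delta>1 * int hy = int \<beta>h * ?K"
    using h_slope by (simp add: algebra_simps flip: hy)
  finally have "int y * ?K = (s * int \<beta>h) * ?K" by (simp only: mult.assoc)
  moreover have "0 < ?K"
    using \<delta>1_pos \<delta>2(2) r_pos by (simp add: add_nonneg_pos)
  ultimately have "int y = s * int \<beta>h" by (simp only: mult_cancel_right) simp
  then have "int \<beta>h dvd int y" by simp
  then show ?thesis by simp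
qed

text \<open>Subtracting \<open>(\<eta>, \<epsilon>)\<close> from a point with \<open>s \<ge> \<eta>\<close> keeps it admissible without raising its value, so a
  step has \<open>s < \<eta>\<close>, that is \<open>s \<delta>1 \<le> \<epsilon> \<delta>2\<close>. Equality would make \<open>\<beta>h\<close> a divisor of \<open>\<epsilon>\<close>, against
  \<open>\<epsilon> < \<beta>h\<close>.\<close>
lemma B_step_bounds_eps:
  assumes "B.step s" "\<epsilon> < \<beta>h"
  shows "B.top s \<le> \<epsilon>"
proof -
  let ?t = "B.top s"
  have \<eta>_pos: "0 < \<eta>" using \<epsilon>\<eta>(1,2) \<delta>1_pos \<delta>2(2) by (cases \<eta>) (auto simp: mult_less_0_iff)
  have adm: "int s * \<delta>1 < int ?t * \<delta>2" using B.adm_top[of s] by (simp add: B.adm_def)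
  have "s < \<eta>"
  proof (rule ccontr)
    assume "\<not> s < \<eta>"
    then obtain x where x: "s = \<eta> + x" by (metis le_iff_add not_less)
    have "0 \<le> int x * \<delta>1" using \<delta>1_pos by simp
    then have "int \<epsilon> * \<delta>2 \<le> int s * \<delta>1"
      using \<epsilon>\<eta>(2) unfolding x of_nat_add distrib_right by (simp add: mult.commute)
    then have "int \<epsilon> * \<delta>2 < int ?t * \<delta>2" using adm by linarith
    then have "\<epsilon> < ?t" using \<delta>2 by simp
    then obtain y where y: "?t = \<epsilon> + y" by (metis le_iff_add less_imp_le_nat)
    have "int x * \<delta>1 < int y * \<delta>2"
      using adm \<epsilon>\<eta>(2) unfolding y by (simp add: x algebra_simps)
    then have "B.adm x y" by (simp add: B.adm_def)
    then have "B.val x (B.top x) \<le> B.val x y" by (simp add: B.adm_iff B.val_mono)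
    also have "\<dots> \<le> B.val s ?t"
    proof -
      have "int (\<eta> * r13) \<le> int (\<epsilon> * r23)" using \<epsilon>\<eta>(3) by (simp only: of_nat_le_iff)
      then show ?thesis unfolding B.val_def y by (simp add: x algebra_simps)
    qed
    also have "\<dots> < B.val x (B.top x)" using B.step_less[OF assms(1), of x] \<eta>_pos by (simp add: x)
    finally show False by simp
  qed
  then have "\<not> \<delta>2 * int \<epsilon> < int s * \<delta>1" using \<eta>_min[of s] by auto
  moreover have "int s * \<delta>1 \<noteq> int \<epsilon> * \<delta>2"
  proof
    assume "int s * \<delta>1 = int \<epsilon> * \<delta>2"
    then have "\<beta>h dvd \<epsilon>" by (rule h_primitive)
    then show False using assms(2) \<epsilon>\<eta>(1) by (simp add: nat_dvd_not_less)
  qed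
  ultimately have "B.adm s \<epsilon>" by (simp add: B.adm_def mult.commute)
  then show ?thesis by (simp add: B.adm_iff)
qed

lemma slope_multiple_ge_eps:
  assumes "0 < n" "e * r13 = n * r23" shows "\<epsilon> \<le> n"
proof (rule \<epsilon>_min[OF assms(1)])
  have "int n * (\<delta>2 * int r13) < int n * (\<delta>1 * int r23)"
    using slope assms(1) by (intro mult_strict_left_mono) auto
  moreover have "int n * int r23 = int e * int r13" using assms(2) by (simp flip: of_nat_mult)
  ultimately have "(\<delta>2 * int n) * int r13 < (int e * \<delta>1) * int r13"
    by (simp add: algebra_simps)
  then show "\<delta>2 * int n < int e * \<delta>1" using r_pos by simp
qed (use assms in simp)

lemma coincident_values_sum:
  assumes "A.val s t = B.val x y"
  shows "(t + x) * r13 = (s + y) * r23"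
proof -
  have "int ((t + x) * r13) = int ((s + y) * r23)"
    using assms by (simp add: A.val_def B.val_def algebra_simps)
  then show ?thesis by (simp only: of_nat_eq_iff)
qed

text \<open>A common value \<open>t r13 - s r23 = y r23 - x r13\<close> gives \<open>(t + x) / (s + y) = r23 / r13\<close>, a number in the
  interval, so \<open>s + y \<ge> \<epsilon>\<close>. For two common values the difference of the two denominators is again at
  least \<open>\<epsilon>\<close>, and the larger one would be at least \<open>2 \<epsilon>\<close>; but it is less than \<open>2 M\<close>.\<close>
lemma card_steps:
  assumes SA: "SA \<subseteq> {s. A.step s \<and> s < M}" and SB: "\<And>s. B.step s \<Longrightarrow> B.top s \<le> M" and M: "M \<le> \<epsilon>"
  shows "card SA + card {s. B.step s} \<le> max r13 r23 + 1"
proof -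
  let ?SB = "{s. B.step s}"
  let ?a = "\<lambda>s. A.val s (A.top s)" and ?b = "\<lambda>s. B.val s (B.top s)"
  have inj: "inj_on ?a SA" using A.inj_on_val by (rule inj_on_subset) (use SA in auto)
  have fin: "finite SA" "finite ?SB"
    using A.finite_steps B.finite_steps SA by (auto intro: finite_subset)
  have "?a ` SA \<union> ?b ` ?SB \<subseteq> {1..int (max r13 r23)}"
    using A.step_val_bounds B.step_val_bounds SA by fastforce
  then have "card (?a ` SA \<union> ?b ` ?SB) \<le> card {1..int (max r13 r23)}"
    by (intro card_mono) auto
  moreover have "card (?a ` SA \<inter> ?b ` ?SB) \<le> 1"
  proof -
    have no: False if "v' < v" and v: "v \<in> ?a ` SA \<inter> ?b ` ?SB" "v' \<in> ?a ` SA \<inter> ?b ` ?SB" for v v'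
    proof -
      from v obtain s s' x x' where s: "s \<in> SA" "v = ?a s" "s' \<in> SA" "v' = ?a s'"
        and x: "B.step x" "v = ?b x" "B.step x'" "v' = ?b x'"
        by (auto simp: image_iff)
      have st: "A.step s" "A.step s'" "s' < M" using s SA by auto
      have "s < s'" using A.step_less[OF st(1), of s'] \<open>v' < v\<close> s by (metis linorder_neqE_nat not_less_iff_gr_or_eq)
      moreover have "x < x'" using B.step_less[OF x(1), of x'] \<open>v' < v\<close> x by (metis linorder_neqE_nat not_less_iff_gr_or_eq)
      ultimately have tops: "A.top s \<le> A.top s'" "B.top x \<le> B.top x'"
        by (auto intro: A.top_mono B.top_mono)
      have e: "(A.top s + x) * r13 = (s + B.top x) * r23"
        by (rule coincident_values_sum) (use s x in simp)
      have e': "(A.top s' + x') * r13 = (s' + B.top x') * r23"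
        by (rule coincident_values_sum) (use s x in simp)
      have "0 < B.top x" using B.adm_top[of x] \<delta>1_pos
        by (cases "B.top x") (auto simp: B.adm_def mult_less_0_iff)
      then have 1: "\<epsilon> \<le> s + B.top x" using slope_multiple_ge_eps[OF _ e] by simp
      have "((A.top s' + x') - (A.top s + x)) * r13 = ((s' + B.top x') - (s + B.top x)) * r23"
        using e e' by (simp only: diff_mult_distrib)
      then have 2: "\<epsilon> \<le> (s' + B.top x') - (s + B.top x)"
        using \<open>s < s'\<close> tops by (intro slope_multiple_ge_eps) auto
      show False using 1 2 st(3) SB[OF x(3)] M tops \<open>s < s'\<close> by linarith
    qed
    have "finite (?a ` SA \<inter> ?b ` ?SB)" using fin by (intro finite_Int disjI1 finite_imageI)
    from card_le_Suc0_iff_eq[OF this] show ?thesis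
      unfolding One_nat_def using no by (meson linorder_neqE)
  qed
  moreover have "card (?a ` SA) + card (?b ` ?SB) = card (?a ` SA \<union> ?b ` ?SB) + card (?a ` SA \<inter> ?b ` ?SB)"
    using fin by (intro card_Un_Int) auto
  ultimately show ?thesis
    using card_image[OF inj] card_image[OF B.inj_on_val] by simp
qed

section \<open>The initial ideal\<close>

definition exAs :: "nat \<Rightarrow> mon set" where
  "exAs M = (\<lambda>s. exA (A.top s) s) ` {s. A.step s \<and> s < M}"

definition exBs :: "mon set" where
  "exBs = (\<lambda>s. exB s (B.top s)) ` {s. B.step s}"

definition initial_ideal :: "'k::field poly3 set" where
  "initial_ideal = ideal_gen (monomial ` improvable n1 n2 n3 \<union> {hbin})"

lemma exps_improvable: "{xyz 0 0 c3, exg} \<union> exAs M \<union> exBs \<subseteq> improvable n1 n2 n3"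
  using improvable_c3 improvable_exg improvable_exA[OF A.adm_top] improvable_exB[OF B.adm_top]
  by (auto simp: exAs_def exBs_def)

text \<open>The common pattern of the three descriptions of the initial ideal. That the generators lie in it is clear, as
  their exponents are improvable.\<close>
lemma initial_ideal_eqI:
  fixes G :: "'k::field poly3 set"
  assumes "G \<subseteq> monomial ` ({xyz 0 0 c3, exg} \<union> exAs M \<union> exBs) \<union> {hbin}"
    and "monomial (xyz 0 0 c3) \<in> ideal_gen G" "monomial exg \<in> ideal_gen G" "hbin \<in> ideal_gen G"
    and "\<And>\<alpha> \<beta>. A.adm \<beta> \<alpha> \<Longrightarrow> monomial (exA \<alpha> \<beta>) \<in> ideal_gen G"
    and "\<And>s. B.step s \<Longrightarrow> monomial (exB s (B.top s)) \<in> ideal_gen G"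
  shows "initial_ideal = ideal_gen G"
  unfolding initial_ideal_def
proof (rule ideal_gen_eqI)
  show "monomial ` improvable n1 n2 n3 \<union> {hbin} \<subseteq> ideal_gen G"
    using improvable_in_ideal[OF assms(2,3,5,6)] assms(4) by auto
  show "G \<subseteq> ideal_gen (monomial ` improvable n1 n2 n3 \<union> {hbin})"
    using assms(1) exps_improvable[of M] by (fastforce intro: ideal_gen_base)
qed

lemma initial_ideal_all:
  "initial_ideal = ideal_gen (monomial ` ({xyz 0 0 c3, exg} \<union> exAs \<epsilon> \<union> exBs) \<union> {hbin :: 'k::field poly3})"
  (is "_ = ideal_gen ?G")
proof (rule initial_ideal_eqI[OF order_refl])
  show g: "monomial exg \<in> ideal_gen ?G" by (rule ideal_gen_base) auto
  show "monomial (exA \<alpha> \<beta>) \<in> ideal_gen ?G" if "A.adm \<beta> \<alpha>" for \<alpha> \<beta>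
    by (rule exA_steps_in_ideal[OF _ g that]) (auto simp: exAs_def intro: ideal_gen_base)
qed (auto simp: exBs_def intro!: ideal_gen_base)

lemma initial_ideal_h:
  assumes "\<beta>h \<le> \<epsilon>"
  shows "initial_ideal = ideal_gen (monomial ` ({xyz 0 0 c3} \<union> exAs \<beta>h \<union> exBs) \<union> {hbin :: 'k::field poly3})"
  (is "_ = ideal_gen ?G")
proof (rule initial_ideal_eqI)
  show "?G \<subseteq> monomial ` ({xyz 0 0 c3, exg} \<union> exAs \<beta>h \<union> exBs) \<union> {hbin}" by auto
  show h: "hbin \<in> ideal_gen ?G" by (rule ideal_gen_base) auto
  show A: "monomial (exA \<alpha> \<beta>) \<in> ideal_gen ?G" if "A.adm \<beta> \<alpha>" for \<alpha> \<beta>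
    by (rule exA_in_ideal_h[OF h _ that]) (auto simp: exAs_def intro: ideal_gen_base)
  show "monomial exg \<in> ideal_gen ?G" by (rule exg_in_ideal_h[OF h assms A])
qed (auto simp: exBs_def intro!: ideal_gen_base)

lemma initial_ideal_g:
  assumes "\<epsilon> < \<beta>h"
  shows "initial_ideal = ideal_gen (monomial ` ({xyz 0 0 c3, exg} \<union> exAs \<epsilon> \<union> exBs) :: 'k::field poly3 set)"
  (is "_ = ideal_gen ?G")
proof (rule initial_ideal_eqI)
  show "?G \<subseteq> monomial ` ({xyz 0 0 c3, exg} \<union> exAs \<epsilon> \<union> exBs) \<union> {hbin}" by auto
  show g: "monomial exg \<in> ideal_gen ?G" by (rule ideal_gen_base) auto
  show B: "monomial (exB s (B.top s)) \<in> ideal_gen ?G" if "B.step s" for s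
    using that by (auto simp: exBs_def intro: ideal_gen_base)
  show "hbin \<in> ideal_gen ?G" by (rule hbin_in_ideal[OF g assms B])
  show "monomial (exA \<alpha> \<beta>) \<in> ideal_gen ?G" if "A.adm \<beta> \<alpha>" for \<alpha> \<beta>
    by (rule exA_steps_in_ideal[OF _ g that]) (auto simp: exAs_def intro: ideal_gen_base)
qed (auto intro!: ideal_gen_base)

lemma finite_exps: "finite ({xyz 0 0 c3, exg} \<union> exAs M \<union> exBs)"
  using A.finite_steps B.finite_steps by (auto simp: exAs_def exBs_def)

lemma exps_X_small:
  assumes "e \<in> {xyz 0 0 c3, exg} \<union> exAs M \<union> exBs"
  shows "Poly_Mapping.lookup e X < hx"
proof -
  have "0 < hx" using h_pos coeff_less by (simp flip: hx)
  moreover have "s * c1 + B.top s * r21 < hx" if "B.step s" for s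
    using B_step_bounds[OF that] coeff_less r_pos unfolding hx[symmetric]
    by (intro add_less_le_mono) auto
  ultimately show ?thesis
    using assms by (auto simp: exg_def exAs_def exA_def exBs_def exB_def)
qed

lemma initial_ideal_groebner:
  assumes "G \<subseteq> monomial ` ({xyz 0 0 c3, exg} \<union> exAs \<epsilon> \<union> exBs) \<union> {hbin :: 'k::field poly3}"
    and "ideal_gen G = initial_ideal"
  shows "groebner_basis G initial_ideal"
proof -
  let ?E = "{xyz 0 0 c3, exg} \<union> exAs \<epsilon> \<union> exBs"
  have cover: "\<exists>e\<in>?E. \<exists>t. m = t + e" if m: "m \<in> improvable n1 n2 n3" for m
  proof -
    let ?H = "monomial ` ?E :: 'k poly3 set"
    have g: "monomial exg \<in> ideal_gen ?H" by (rule ideal_gen_base) auto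
    have A: "monomial (exA \<alpha> \<beta>) \<in> ideal_gen ?H" if "A.adm \<beta> \<alpha>" for \<alpha> \<beta>
      by (rule exA_steps_in_ideal[OF _ g that]) (auto simp: exAs_def intro: ideal_gen_base)
    have z: "monomial (xyz 0 0 c3) \<in> ideal_gen ?H" by (rule ideal_gen_base) auto
    have B: "monomial (exB s (B.top s)) \<in> ideal_gen ?H" if "B.step s" for s
      using that by (auto simp: exBs_def intro: ideal_gen_base)
    have "monomial m \<in> ideal_gen ?H" by (rule improvable_in_ideal[OF z g A B m])
    then obtain p e t where p: "p \<in> ?H" "e \<in> Poly_Mapping.keys p" "m = t + e"
      by (rule key_in_ideal_gen[of _ _ m]) auto
    then obtain e' where "e' \<in> ?E" "p = monomial e'" by blast
    with p show ?thesis by auto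
  qed
  have "groebner_basis G (ideal_gen G)"
    using assms(2) cover exps_X_small[of _ \<epsilon>] unfolding initial_ideal_def
    by (intro groebner_basis_of_generators[OF assms(1) finite_exps _ exps_improvable]) blast+
  then show ?thesis by (simp only: assms(2))
qed

lemma card_image_steps:
  "card (exAs M) \<le> card {s. A.step s \<and> s < M}" "card exBs \<le> card {s. B.step s}"
  unfolding exAs_def exBs_def using A.finite_steps B.finite_steps by (auto intro!: card_image_le)

lemma mu_initial_ideal: "mu (initial_ideal :: 'k::field poly3 set) \<le> max r13 r23 + 3"
proof -
  have fin: "finite (exAs M)" "finite exBs" for M
    using A.finite_steps B.finite_steps by (auto simp: exAs_def exBs_def)
  have mu: "mu (initial_ideal :: 'k poly3 set) \<le> 2 + card (exAs M) + card exBs"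
    if G: "initial_ideal = ideal_gen ({p, q} \<union> monomial ` (exAs M \<union> exBs) :: 'k poly3 set)" for p q M
  proof -
    have "mu (initial_ideal :: 'k poly3 set) \<le> card ({p, q} \<union> monomial ` (exAs M \<union> exBs) :: 'k poly3 set)"
      using G fin by (intro mu_le_card) auto
    also have "\<dots> \<le> card {p, q} + card (monomial ` (exAs M \<union> exBs) :: 'k poly3 set)"
      by (rule card_Un_le)
    also have "\<dots> \<le> 2 + card (exAs M \<union> exBs)"
      using fin by (intro add_mono card_image_le) (auto simp: card_insert_if)
    also have "\<dots> \<le> 2 + card (exAs M) + card exBs"
      using card_Un_le[of "exAs M" exBs] by simp
    finally show ?thesis .
  qed
  have bound: "card (exAs M) + card exBs \<le> max r13 r23 + 1"
    if "\<And>s. B.step s \<Longrightarrow> B.top s \<le> M" "M \<le> \<epsilon>" for M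
    using card_steps[OF order_refl that] card_image_steps(1)[of M] card_image_steps(2) by linarith
  show ?thesis
  proof (cases "\<beta>h \<le> \<epsilon>")
    case True
    have "(initial_ideal :: 'k poly3 set) = ideal_gen (monomial ` ({xyz 0 0 c3} \<union> exAs \<beta>h \<union> exBs) \<union> {hbin})"
      by (rule initial_ideal_h[OF True])
    also have "monomial ` ({xyz 0 0 c3} \<union> exAs \<beta>h \<union> exBs) \<union> {hbin} =
        {monomial (xyz 0 0 c3), hbin} \<union> (monomial ` (exAs \<beta>h \<union> exBs) :: 'k poly3 set)" by auto
    finally have "initial_ideal =
        ideal_gen ({monomial (xyz 0 0 c3), hbin} \<union> monomial ` (exAs \<beta>h \<union> exBs) :: 'k poly3 set)" .
    from mu[OF this] bound[OF B_step_bounds(2) True] show ?thesis by simp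
  next
    case False
    then have lt: "\<epsilon> < \<beta>h" by simp
    have "(initial_ideal :: 'k poly3 set) = ideal_gen (monomial ` ({xyz 0 0 c3, exg} \<union> exAs \<epsilon> \<union> exBs))"
      by (rule initial_ideal_g[OF lt])
    also have "monomial ` ({xyz 0 0 c3, exg} \<union> exAs \<epsilon> \<union> exBs) =
        {monomial (xyz 0 0 c3), monomial exg} \<union> (monomial ` (exAs \<epsilon> \<union> exBs) :: 'k poly3 set)" by auto
    finally have "initial_ideal =
        ideal_gen ({monomial (xyz 0 0 c3), monomial exg} \<union> monomial ` (exAs \<epsilon> \<union> exBs) :: 'k poly3 set)" .
    from mu[OF this] bound[OF B_step_bounds_eps[OF _ lt] order_refl] show ?thesis by simp
  qed
qed

end

section \<open>The combinatorial data of the theorem\<close>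

text \<open>The fraction \<open>r23 / r13\<close> itself lies in the interval, so \<open>\<epsilon>\<close> exists. Numerators in the interval are positive,
  which turns the minimum over the integers that defines \<open>\<eta>\<close> into one over the natural numbers. In
  the last claim \<open>e\<close> is only compared with the lower end of the interval: if \<open>e\<close> were less than \<open>\<eta>\<close>, then
  \<open>e / \<epsilon>\<close> would not exceed the upper end either.\<close>
lemma eps_eta_characterization:
  fixes r13 r23 :: nat and \<delta>1 \<delta>2 :: int
  assumes pos: "0 < r13" "0 < \<delta>1" "0 < \<delta>2" and slope: "\<delta>2 * int r13 < \<delta>1 * int r23"
  defines "\<epsilon> \<equiv> eps_of (real_of_int \<delta>2 / real_of_int \<delta>1) (real r23 / real r13)"
    and "\<eta> \<equiv> eta_of (real_of_int \<delta>2 / real_of_int \<delta>1) (real r23 / real r13)"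
  shows "0 < \<epsilon>" "\<delta>2 * int \<epsilon> < int (nat \<eta>) * \<delta>1" "nat \<eta> * r13 \<le> \<epsilon> * r23"
    and "0 < n \<Longrightarrow> \<delta>2 * int n < int e * \<delta>1 \<Longrightarrow> e * r13 \<le> n * r23 \<Longrightarrow> \<epsilon> \<le> n"
    and "\<delta>2 * int \<epsilon> < int e * \<delta>1 \<Longrightarrow> nat \<eta> \<le> e"
proof -
  define win where "win = (\<lambda>n (e :: int). \<delta>2 * int n < e * \<delta>1 \<and> e * int r13 \<le> int n * int r23)"
  have win_iff: "real_of_int \<delta>2 / real_of_int \<delta>1 < real_of_int e / real n \<and>
      real_of_int e / real n \<le> real r23 / real r13 \<longleftrightarrow> win n e" if "0 < n" for n e
  proof -
    have "real_of_int \<delta>2 / real_of_int \<delta>1 < real_of_int e / real n \<longleftrightarrow>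
        real_of_int (\<delta>2 * int n) < real_of_int (e * \<delta>1)"
      using that pos by (simp add: field_simps)
    moreover have "real_of_int e / real n \<le> real r23 / real r13 \<longleftrightarrow>
        real_of_int (e * int r13) \<le> real_of_int (int n * int r23)"
      using that pos by (simp add: field_simps)
    ultimately show ?thesis unfolding win_def of_int_less_iff of_int_le_iff by blast
  qed
  have win_pos: "0 < e" if "win n e" for n e
  proof -
    have "0 \<le> \<delta>2 * int n" using pos by simp
    then have "0 < e * \<delta>1" using that unfolding win_def by linarith
    then show ?thesis using pos by (simp add: zero_less_mult_iff)
  qed
  have eps: "\<epsilon> = (LEAST n. 0 < n \<and> (\<exists>e. win n e))"
    unfolding \<epsilon>_def eps_of_def using win_iff by (metis (no_types, lifting))
  have "0 < r13 \<and> (\<exists>e. win r13 e)"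
    using pos slope by (intro conjI exI[of _ "int r23"]) (simp_all add: win_def mult.commute)
  then have \<epsilon>: "0 < \<epsilon> \<and> (\<exists>e. win \<epsilon> e)" unfolding eps by (rule LeastI)
  then show "0 < \<epsilon>" by simp
  have \<epsilon>_le: "\<epsilon> \<le> n" if "0 < n" "win n e" for n e
    unfolding eps using that by (intro Least_le) blast
  obtain e0 where e0: "win \<epsilon> e0" using \<epsilon> by blast
  define m where "m = (LEAST k. win \<epsilon> (int k))"
  have "win \<epsilon> (int (nat e0))" using e0 win_pos[OF e0] by simp
  then have m: "win \<epsilon> (int m)" unfolding m_def by (rule LeastI)
  have m_le: "int m \<le> e" if "win \<epsilon> e" for e
  proof -
    have "win \<epsilon> (int (nat e))" using that win_pos[OF that] by simp
    then have "m \<le> nat e" unfolding m_def by (rule Least_le)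
    then show ?thesis using win_pos[OF that] by simp
  qed
  have "\<eta> = (LEAST e. win \<epsilon> e)"
    unfolding \<eta>_def eta_of_def \<epsilon>_def[symmetric] using win_iff \<epsilon> by simp
  also have "\<dots> = int m" by (rule Least_equality) (use m m_le in auto)
  finally have \<eta>: "nat \<eta> = m" by simp
  show "\<delta>2 * int \<epsilon> < int (nat \<eta>) * \<delta>1" using m by (simp add: \<eta> win_def)
  have "int (m * r13) \<le> int (\<epsilon> * r23)" using m by (simp add: win_def)
  then show "nat \<eta> * r13 \<le> \<epsilon> * r23" unfolding \<eta> by (simp only: of_nat_le_iff)
  show "\<epsilon> \<le> n" if "0 < n" "\<delta>2 * int n < int e * \<delta>1" "e * r13 \<le> n * r23" for n e
  proof (rule \<epsilon>_le[OF that(1)])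
    have "int (e * r13) \<le> int (n * r23)" using that(3) by (simp only: of_nat_le_iff)
    then show "win n (int e)" using that(2) by (simp add: win_def)
  qed
  show "nat \<eta> \<le> e" if "\<delta>2 * int \<epsilon> < int e * \<delta>1" for e
  proof (rule ccontr)
    assume "\<not> nat \<eta> \<le> e"
    then have lt: "int e < int m" by (simp add: \<eta>)
    then have "int e * int r13 \<le> int m * int r13" by (intro mult_right_mono) auto
    then have "win \<epsilon> (int e)" using that m by (simp add: win_def)
    from m_le[OF this] lt show False by simp
  qed
qed

context tangent_cone
begin

lemma p_mon_eq: "p_mon c2 r12 r13 r23 (\<alpha>, \<beta>) = (monomial (exA \<alpha> \<beta>) :: 'k::field poly3)"
  by (simp add: p_mon_def exA_def indet_powers mono_mult xyz_add)

lemma q_mon_eq: "q_mon c1 r21 r13 r23 (\<gamma>, \<sigma>) = (monomial (exB \<gamma> \<sigma>) :: 'k::field poly3)"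
  by (simp add: q_mon_def exB_def indet_powers mono_mult xyz_add)

lemma p_mon_image:
  assumes "M \<le> \<epsilon>"
  shows "p_mon c2 r12 r13 r23 ` {(\<alpha>, \<beta>) \<in> A_set r13 r23 \<epsilon>. \<beta> < M} = (monomial ` exAs M :: 'k::field poly3 set)"
proof -
  have "{(\<alpha>, \<beta>) \<in> A_set r13 r23 \<epsilon>. \<beta> < M} = (\<lambda>s. (A.top s, s)) ` {s. A.step s \<and> s < M}"
    unfolding A_set_eq_steps[OF r_pos(2,4) \<epsilon>\<eta>(1)] using assms by auto
  then show ?thesis by (simp add: exAs_def image_image p_mon_eq)
qed

lemma p_mon_image_all:
  "p_mon c2 r12 r13 r23 ` A_set r13 r23 \<epsilon> = (monomial ` exAs \<epsilon> :: 'k::field poly3 set)"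
  unfolding A_set_eq_steps[OF r_pos(2,4) \<epsilon>\<eta>(1)] by (simp add: exAs_def image_image p_mon_eq)

lemma q_mon_image:
  "q_mon c1 r21 r13 r23 ` B_set r13 r23 \<delta>1 \<delta>2 = (monomial ` exBs :: 'k::field poly3 set)"
  unfolding B_set_eq_steps[OF r_pos(2,4) \<delta>1_pos \<delta>2(2) slope] by (simp add: exBs_def image_image q_mon_eq)

lemma indet_binomial: "indet Y ^ hy - indet X ^ hx * indet Z ^ hz = (hbin :: 'k::field poly3)"
  by (simp add: hbin_def indet_powers mono_mult xyz_add)

end

theorem lemma4p9:
  fixes n1 n2 n3 a b d c1 c2 c3 r12 r13 r21 r23 r31 r32 \<alpha>h \<beta>h \<epsilon> :: nat
    and \<delta>1 \<delta>2 \<eta> :: int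
    and A B :: "(nat \<times> nat) set"
    and I Istar P Q :: "'k::field poly3 set"
    and g h :: "'k poly3"
  assumes "0 < n1" "n1 < n2" "n2 < n3"
    and "gcd n1 (gcd n2 n3) = 1"
    and "minimally_generates {n1, n2, n3} (nat_semigroup {n1, n2, n3})"
    and "I = semigroup_ideal n1 n2 n3"
    and "\<not> complete_intersection I"
    and "Istar = initial_form_ideal I"
    and "a = n2 - n1" "b = n3 - n1" "d = gcd a b"
    and "c1 = least_mult n1 {n2, n3}" "c2 = least_mult n2 {n1, n3}" "c3 = least_mult n3 {n1, n2}"
    and "c1 * n1 = r12 * n2 + r13 * n3"
    and "c2 * n2 = r21 * n1 + r23 * n3"
    and "c3 * n3 = r31 * n1 + r32 * n2"
    and "\<delta>1 = int c1 - int r12 - int r13" "\<delta>2 = int c2 - int r21 - int r23"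
    and "0 < \<alpha>h" "0 < \<beta>h"
    and "\<alpha>h * c1 + \<beta>h * r21 = (b - a) div d"
    and "\<alpha>h * r12 + \<beta>h * c2 = b div d"
    and "- int \<alpha>h * int r13 + int \<beta>h * int r23 = int (a div d)"
    and "\<epsilon> = eps_of (real_of_int \<delta>2 / real_of_int \<delta>1) (real r23 / real r13)"
    and "\<eta> = eta_of (real_of_int \<delta>2 / real_of_int \<delta>1) (real r23 / real r13)"
    and "A = A_set r13 r23 \<epsilon>"
    and "B = B_set r13 r23 \<delta>1 \<delta>2"
    and "P = p_mon c2 r12 r13 r23 ` A"
    and "Q = q_mon c1 r21 r13 r23 ` B"
    and "r12 \<noteq> 0" "r13 \<noteq> 0" "r21 \<noteq> 0" "r23 \<noteq> 0" "r31 \<noteq> 0" "r32 \<noteq> 0"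
    and "c2 > r21 + r23"
    and "g = indet Y ^ (nat \<eta> * r12 + \<epsilon> * c2)"
    and "h = indet Y ^ (b div d) - indet X ^ ((b - a) div d) * indet Z ^ (a div d)"
  shows "Istar = ideal_gen ({indet Z ^ c3, g, h} \<union> P \<union> Q) \<and>
    (\<beta>h \<le> \<epsilon> \<longrightarrow>
      Istar = ideal_gen ({indet Z ^ c3, h} \<union> p_mon c2 r12 r13 r23 ` {(\<alpha>, \<beta>) \<in> A. \<beta> < \<beta>h} \<union> Q)) \<and>
    (\<beta>h > \<epsilon> \<longrightarrow> Istar = ideal_gen ({indet Z ^ c3, g} \<union> P \<union> Q)) \<and>
    (\<forall>G. G \<subseteq> {indet Z ^ c3, g, h} \<union> P \<union> Q \<and> minimal_generating_set G Istar
      \<longrightarrow> groebner_basis G Istar) \<and>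
    mu Istar \<le> max r13 r23 + 3"
proof -
  note n = assms(1-3) and Istar = assms(6,8) and ab = assms(9-11) and c = assms(12-14)
    and rels = assms(15-17) and \<delta> = assms(18,19) and h_pos = assms(20,21) and h_eqs = assms(22-24)
    and \<epsilon>\<eta> = assms(25,26) and sets = assms(27-30) and r = assms(31-36) and c2 = assms(37)
    and gh = assms(38,39)
  define hx hy hz where hxyz: "hx = (b - a) div d" "hy = b div d" "hz = a div d"
  have a_pos: "0 < a" "a < b" using n ab by auto
  then have d_pos: "0 < d" by (simp add: ab(3))
  have d_dvd: "d dvd a" "d dvd b" by (simp_all add: ab(3))
  have hz_pos: "0 < hz" using d_dvd(1) a_pos d_pos by (auto simp: hxyz elim!: dvdE)
  have d_mult: "a = d * hz" "b = d * hy" using d_dvd by (simp_all add: hxyz)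
  have "b - a = d * (hy - hz)" by (simp add: d_mult diff_mult_distrib2)
  then have "hx = hy - hz" using d_pos by (simp add: hxyz(1))
  moreover have "hz < hy" using a_pos(2) d_pos by (simp add: d_mult)
  ultimately have hsum: "hx + hz = hy" by simp
  have hcop: "coprime hy hz"
    unfolding hxyz ab(3) using a_pos by (subst coprime_commute, intro div_gcd_coprime) auto
  have hz_eq: "\<beta>h * r23 = \<alpha>h * r13 + hz"
  proof -
    have "int (\<beta>h * r23) = int (\<alpha>h * r13 + hz)" using h_eqs(3) by (simp add: hxyz)
    then show ?thesis by (simp only: of_nat_eq_iff)
  qed
  have n_diff: "n2 = n1 + d * hz" "n3 = n1 + d * hy"
    using n ab(1,2) unfolding d_mult[symmetric] by simp_all
  have min: "c1 \<le> y" if "0 < y" "y * n1 = i * n2 + j * n3" for y i j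
    unfolding c(1) by (rule least_mult_le[OF _ that]) (use n in simp)
  have min': "c2 \<le> y" if "0 < y" "y * n2 = i * n1 + j * n3" for y i j
    unfolding c(2) by (rule least_mult_le[OF _ that]) (use n in simp)
  have min'': "c3 \<le> y" if "0 < y" "y * n3 = i * n1 + j * n2" for y i j
    unfolding c(3) by (rule least_mult_le[OF _ that]) (use n in simp)
  interpret herzog_relations n1 n2 n3 c1 c2 c3 r12 r13 r21 r23 r31 r32
    by (rule herzog_relations.intro; (rule n rels min min' min'' | (use r in simp)); assumption?)
  interpret homogeneous_relation n1 n2 n3 c1 c2 c3 r12 r13 r21 r23 r31 r32 \<alpha>h \<beta>h hx hy hz d \<delta>1 \<delta>2
  proof
    show "0 < \<delta>2" using c2 \<delta> by simp
    show "\<alpha>h * c1 + \<beta>h * r21 = hx" "\<alpha>h * r12 + \<beta>h * c2 = hy"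
      unfolding hxyz by (rule h_eqs)+
  qed (rule \<delta> h_pos hz_eq hz_pos hsum hcop n_diff d_pos)+
  note eps = eps_eta_characterization[OF r_pos(2) \<delta>1_pos \<delta>2(2) slope, folded \<epsilon>\<eta>]
  interpret tangent_cone n1 n2 n3 c1 c2 c3 r12 r13 r21 r23 r31 r32 \<alpha>h \<beta>h hx hy hz d \<delta>1 \<delta>2 \<epsilon> "nat \<eta>"
    by unfold_locales (fact eps)+
  have I: "Istar = initial_ideal"
    unfolding Istar initial_ideal_def by (rule initial_ideal_eq)
  have z: "indet Z ^ c3 = (monomial (xyz 0 0 c3) :: 'k poly3)" by (rule indet_powers)
  have g: "g = monomial exg" by (simp add: gh exg_def indet_powers)
  have h: "h = hbin" unfolding gh hxyz[symmetric] by (rule indet_binomial)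
  have P: "P = monomial ` exAs \<epsilon>" unfolding sets by (rule p_mon_image_all)
  have Q: "Q = monomial ` exBs" unfolding sets by (rule q_mon_image)
  have gens: "{indet Z ^ c3, g, h} \<union> P \<union> Q =
      monomial ` ({xyz 0 0 c3, exg} \<union> exAs \<epsilon> \<union> exBs) \<union> {hbin}"
    unfolding z g h P Q by auto
  show ?thesis
  proof (intro conjI impI allI)
    show "Istar = ideal_gen ({indet Z ^ c3, g, h} \<union> P \<union> Q)"
      unfolding gens I by (rule initial_ideal_all)
  next
    assume le: "\<beta>h \<le> \<epsilon>"
    have "{indet Z ^ c3, h} \<union> p_mon c2 r12 r13 r23 ` {(\<alpha>, \<beta>) \<in> A. \<beta> < \<beta>h} \<union> Q =
        monomial ` ({xyz 0 0 c3} \<union> exAs \<beta>h \<union> exBs) \<union> {hbin}"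
      unfolding z h Q sets(1) p_mon_image[OF le] by auto
    then show "Istar = ideal_gen ({indet Z ^ c3, h} \<union> p_mon c2 r12 r13 r23 ` {(\<alpha>, \<beta>) \<in> A. \<beta> < \<beta>h} \<union> Q)"
      unfolding I using initial_ideal_h[OF le] by (simp only:)
  next
    assume lt: "\<epsilon> < \<beta>h"
    have "{indet Z ^ c3, g} \<union> P \<union> Q = monomial ` ({xyz 0 0 c3, exg} \<union> exAs \<epsilon> \<union> exBs)"
      unfolding z g P Q by auto
    then show "Istar = ideal_gen ({indet Z ^ c3, g} \<union> P \<union> Q)"
      unfolding I using initial_ideal_g[OF lt] by (simp only:)
  next
    fix G assume "G \<subseteq> {indet Z ^ c3, g, h} \<union> P \<union> Q \<and> minimal_generating_set G Istar"
    then show "groebner_basis G Istar"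
      unfolding I gens by (intro initial_ideal_groebner) (auto simp: minimal_generating_set_def)
  next
    show "mu Istar \<le> max r13 r23 + 3" unfolding I by (rule mu_initial_ideal)
  qed
qed

end
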